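(* Let $r_1,\ldots,r_m$, $c_1,\ldots,c_n$ be positive integers with $\sum_i r_i=\sum_j c_j=N$ and let $W=(w_{ij})$ be an $m\times n$ matrix of strictly positive weights. Let $$T(R,C;W)=\sum_D\prod_{i,j}w_{ij}^{d_{ij}},$$ the sum over all $m\times n$ non-negative integer matrices $D=(d_{ij})$ with row sums $r_1,\ldots,r_m$ and column sums $c_1,\ldots,c_n$, and let $$T'(R,C;W)=\frac{N!}{N^N}\cdot\frac{\mathbf{E}\,\sigma(A)}{r_1!\cdots r_m!\,c_1!\cdots c_n!}.$$ Then $$T'(R,C;W)\le T(R,C;W)\le \alpha(R,C)\,T'(R,C;W),\qquad \alpha(R,C)=\frac{N^N}{N!}\min\Big\{\prod_{i=1}^m\frac{r_i!}{r_i^{r_i}},\ \prod_{j=1}^n\frac{c_j!}{c_j^{c_j}}\Big\}.$$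
   Context: For a positive $N\times N$ matrix $A=(a_{ij})$ there exist positive numbers $\xi_1,\ldots,\xi_N,\eta_1,\ldots,\eta_N$ and a doubly stochastic matrix $B=(b_{ij})$ (all row and column sums equal to 1) with $a_{ij}=b_{ij}\xi_i\eta_j$ for all $i,j$; $B$ is unique and the $\xi_i,\eta_j$ are unique up to $\xi_i\mapsto\xi_i\tau$, $\eta_j\mapsto\eta_j\tau^{-1}$. Define $\sigma(A)=\prod_{i=1}^N\xi_i\eta_i$. The random matrix $A=A(\gamma)$ is the $N\times N$ matrix obtained as follows: let $\gamma=(\gamma_{ij})$ be an $m\times n$ matrix of independent standard exponential random variables (density $e^{-t}$ on $t>0$); partition the rows $\{1,\ldots,N\}$ into disjoint sets $R_1,\ldots,R_m$ with $|R_i|=r_i$ and the columns into disjoint sets $C_1,\ldots,C_n$ with $|C_j|=c_j$; every entry of the block $R_i\times C_j$ equals $w_{ij}\gamma_{ij}$. *)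

theory Defs
  imports "HOL-Probability.Probability"
begin

text \<open>Vectors and matrices are functions on \<open>nat\<close>, indexed from 1, of which only the entries
  in the stated range matter.\<close>

definition positive_matrix :: "nat \<Rightarrow> (nat \<Rightarrow> nat \<Rightarrow> real) \<Rightarrow> bool" where
  "positive_matrix N A \<longleftrightarrow> (\<forall>i\<in>{1..N}. \<forall>j\<in>{1..N}. A i j > 0)"

definition doubly_stochastic :: "nat \<Rightarrow> (nat \<Rightarrow> nat \<Rightarrow> real) \<Rightarrow> bool" where
  "doubly_stochastic N B \<longleftrightarrow>
     (\<forall>i\<in>{1..N}. \<forall>j\<in>{1..N}. B i j \<ge> 0) \<and>
     (\<forall>i\<in>{1..N}. (\<Sum>j=1..N. B i j) = 1) \<and>
     (\<forall>j\<in>{1..N}. (\<Sum>i=1..N. B i j) = 1)"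

definition is_scaling ::
  "nat \<Rightarrow> (nat \<Rightarrow> nat \<Rightarrow> real) \<Rightarrow> (nat \<Rightarrow> nat \<Rightarrow> real) \<Rightarrow> (nat \<Rightarrow> real) \<Rightarrow> (nat \<Rightarrow> real) \<Rightarrow> bool" where
  "is_scaling N A B \<xi> \<eta> \<longleftrightarrow>
     doubly_stochastic N B \<and>
     (\<forall>i\<in>{1..N}. \<xi> i > 0) \<and> (\<forall>j\<in>{1..N}. \<eta> j > 0) \<and>
     (\<forall>i\<in>{1..N}. \<forall>j\<in>{1..N}. A i j = B i j * \<xi> i * \<eta> j)"

text \<open>For positive \<open>A\<close> a scaling exists and the product below does not depend on its choice.
  Other matrices get the dummy value 0; for the random matrix considered below they occur with
  probability 0.\<close>

definition scaling_factor :: "nat \<Rightarrow> (nat \<Rightarrow> nat \<Rightarrow> real) \<Rightarrow> real" where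
  "scaling_factor N A =
     (if positive_matrix N A
      then (THE s. \<exists>B \<xi> \<eta>. is_scaling N A B \<xi> \<eta> \<and> s = (\<Prod>i=1..N. \<xi> i * \<eta> i))
      else 0)"

definition partition_with_sizes :: "nat \<Rightarrow> nat \<Rightarrow> (nat \<Rightarrow> nat) \<Rightarrow> (nat \<Rightarrow> nat set) \<Rightarrow> bool" where
  "partition_with_sizes N m r R \<longleftrightarrow>
     disjoint_family_on R {1..m} \<and> (\<Union>i\<in>{1..m}. R i) = {1..N} \<and> (\<forall>i\<in>{1..m}. card (R i) = r i)"

definition block_matrix ::
  "nat \<Rightarrow> nat \<Rightarrow> (nat \<Rightarrow> nat set) \<Rightarrow> (nat \<Rightarrow> nat set) \<Rightarrow> (nat \<Rightarrow> nat \<Rightarrow> real) \<Rightarrow> nat \<Rightarrow> nat \<Rightarrow> real" where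
  "block_matrix m n R C V k l =
     V (THE i. i \<in> {1..m} \<and> k \<in> R i) (THE j. j \<in> {1..n} \<and> l \<in> C j)"

lemma block_matrix_eq:
  assumes "partition_with_sizes N m r R" "partition_with_sizes N n c C"
    and "i \<in> {1..m}" "j \<in> {1..n}" "k \<in> R i" "l \<in> C j"
  shows "block_matrix m n R C V k l = V i j"
proof -
  have "i' = i" if "i' \<in> {1..m}" "k \<in> R i'" for i'
    using assms that unfolding partition_with_sizes_def disjoint_family_on_def by blast
  then have "(THE i. i \<in> {1..m} \<and> k \<in> R i) = i"
    using assms by blast
  moreover have "j' = j" if "j' \<in> {1..n}" "l \<in> C j'" for j'
    using assms that unfolding partition_with_sizes_def disjoint_family_on_def by blast
  then have "(THE j. j \<in> {1..n} \<and> l \<in> C j) = j"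
    using assms by blast
  ultimately show ?thesis
    by (simp add: block_matrix_def)
qed

text \<open>Entries of \<open>D\<close> outside the \<open>m \<times> n\<close> range are fixed to 0, so that every integer matrix is
  counted exactly once.\<close>

definition contingency_tables :: "nat \<Rightarrow> nat \<Rightarrow> (nat \<Rightarrow> nat) \<Rightarrow> (nat \<Rightarrow> nat) \<Rightarrow> (nat \<Rightarrow> nat \<Rightarrow> nat) set" where
  "contingency_tables m n r c =
     {D. (\<forall>i j. i \<notin> {1..m} \<or> j \<notin> {1..n} \<longrightarrow> D i j = 0) \<and>
         (\<forall>i\<in>{1..m}. (\<Sum>j=1..n. D i j) = r i) \<and>
         (\<forall>j\<in>{1..n}. (\<Sum>i=1..m. D i j) = c j)}"

lemma finite_contingency_tables: "finite (contingency_tables m n r c)"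
proof -
  let ?F = "{f. \<forall>p. (p \<in> {1..m} \<times> {1..n} \<longrightarrow> f p \<in> {..\<Sum>i=1..m. r i}) \<and>
                    (p \<notin> {1..m} \<times> {1..n} \<longrightarrow> f p = (0::nat))}"
  have "finite ?F"
    by (rule finite_set_of_finite_funs) auto
  moreover have "contingency_tables m n r c \<subseteq> curry ` ?F"
  proof
    fix D assume D: "D \<in> contingency_tables m n r c"
    have "D i j \<le> (\<Sum>i=1..m. r i)" if "i \<in> {1..m}" "j \<in> {1..n}" for i j
    proof -
      have "D i j \<le> (\<Sum>j=1..n. D i j)"
        using that by (intro member_le_sum) auto
      also have "\<dots> = r i"
        using D that by (auto simp: contingency_tables_def)
      also have "\<dots> \<le> (\<Sum>i=1..m. r i)"
        using that by (intro member_le_sum) auto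
      finally show ?thesis .
    qed
    then have "case_prod D \<in> ?F"
      using D by (auto simp: contingency_tables_def)
    then show "D \<in> curry ` ?F"
      by (metis (no_types, lifting) curry_case_prod image_eqI)
  qed
  ultimately show ?thesis
    by (meson finite_imageI finite_subset)
qed

definition weighted_tables ::
  "nat \<Rightarrow> nat \<Rightarrow> (nat \<Rightarrow> nat) \<Rightarrow> (nat \<Rightarrow> nat) \<Rightarrow> (nat \<Rightarrow> nat \<Rightarrow> real) \<Rightarrow> real" where
  "weighted_tables m n r c w =
     (\<Sum>D\<in>contingency_tables m n r c. \<Prod>i=1..m. \<Prod>j=1..n. w i j ^ D i j)"

definition random_matrix ::
  "nat \<Rightarrow> nat \<Rightarrow> (nat \<Rightarrow> nat set) \<Rightarrow> (nat \<Rightarrow> nat set) \<Rightarrow> (nat \<Rightarrow> nat \<Rightarrow> real) \<Rightarrow>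
   (nat \<Rightarrow> nat \<Rightarrow> 'a \<Rightarrow> real) \<Rightarrow> 'a \<Rightarrow> nat \<Rightarrow> nat \<Rightarrow> real" where
  "random_matrix m n R C w \<gamma> \<omega> = block_matrix m n R C (\<lambda>i j. w i j * \<gamma> i j \<omega>)"

definition approx_tables ::
  "'a measure \<Rightarrow> nat \<Rightarrow> nat \<Rightarrow> nat \<Rightarrow> (nat \<Rightarrow> nat) \<Rightarrow> (nat \<Rightarrow> nat) \<Rightarrow>
   (nat \<Rightarrow> nat set) \<Rightarrow> (nat \<Rightarrow> nat set) \<Rightarrow> (nat \<Rightarrow> nat \<Rightarrow> real) \<Rightarrow> (nat \<Rightarrow> nat \<Rightarrow> 'a \<Rightarrow> real) \<Rightarrow> real" where
  "approx_tables M N m n r c R C w \<gamma> =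
     fact N / real N ^ N *
     ((\<integral>\<omega>. scaling_factor N (random_matrix m n R C w \<gamma> \<omega>) \<partial>M) /
      ((\<Prod>i=1..m. fact (r i)) * (\<Prod>j=1..n. fact (c j))))"

definition approx_ratio :: "nat \<Rightarrow> nat \<Rightarrow> nat \<Rightarrow> (nat \<Rightarrow> nat) \<Rightarrow> (nat \<Rightarrow> nat) \<Rightarrow> real" where
  "approx_ratio N m n r c =
     real N ^ N / fact N *
     min (\<Prod>i=1..m. fact (r i) / real (r i) ^ r i) (\<Prod>j=1..n. fact (c j) / real (c j) ^ c j)"

end

(*
The permanent of the block matrix with blocks V_ij is P(V) = prod r_i! prod c_j! sum_D prod v_ij^d_ij / d_ij!.
Since the moments of a standard exponential variable are E gamma^d = d!, the expectation of P(w_ij gamma_ij)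
is prod r_i! prod c_j! T(R,C;W). On the other hand P(V) = sigma(A) P(U), where U is the doubly stochastic
scaling of V at the level of blocks, so it suffices to show N!/N^N <= P(U) <= prod r_i!/r_i^r_i pointwise;
the bound with the c_j follows by transposition.

P(U) is obtained from the monomial y^r by N directional derivatives along the columns of U. The lower bound is
van der Waerden's inequality by Gurvits' capacity argument: directional derivatives preserve stability, a stable
form is real rooted along positive lines, and the arithmetic-geometric mean inequality for the roots controls
the loss of capacity in each step. For the upper bound, each derivative is an average of rescaled coefficients.
The scaling itself sits at the minimum of a homogeneous function of n positive variables; approximating its
minimiser by rational points also gives measurability of sigma(A).
*)

theory Submission
  imports Defs "HOL-Computational_Algebra.Fundamental_Theorem_Algebra"
begin

section \<open>Directional derivatives of homogeneous forms\<close>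

text \<open>Two normalisations carry the constants. A form is stored by its coefficients relative to
  \<open>y^a / a!\<close>, so that a derivative is a mere shift of the index, and evaluation by
  repeated differentiation returns \<open>k!\<close> times the value. So measured, the step from
  degree K to K - 1 costs the factor (K-1)^(K-1) / K^K. These factors telescope to 1 / N^N, and the
  N! of the lower bound is the one contained in the evaluation of the starting monomial. The
  permanent occurs only as the constant left after N derivatives, never as a sum over permutations.

  The two bounds consume different data: averaging uses the column sums alone, hence one upper bound
  for each side, whereas the capacity argument uses the row sums as well, which forces a genuine
  scaling. The definition of \<sigma> by a choice of scaling says nothing about its dependence on
  the entries; its description as a minimal value does, and integrability then follows from the
  lower bound itself.\<close>

definition dird :: "nat set \<Rightarrow> (nat \<Rightarrow> 'a::comm_ring_1) \<Rightarrow> ((nat \<Rightarrow> nat) \<Rightarrow> 'a) \<Rightarrow> (nat \<Rightarrow> nat) \<Rightarrow> 'a" where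
  "dird I b g a = (\<Sum>i\<in>I. b i * g (a(i := Suc (a i))))"

lemma dird_commute: "dird I b (dird I d g) = dird I d (dird I b g)"
proof
  fix a
  have "dird I b (dird I d g) a =
      (\<Sum>i\<in>I. \<Sum>j\<in>I. b i * (d j * g ((a(i := Suc (a i)))(j := Suc ((a(i := Suc (a i))) j)))))"
    by (simp add: dird_def sum_distrib_left del: fun_upd_apply)
  also have "\<dots> = (\<Sum>j\<in>I. \<Sum>i\<in>I. d j * (b i * g ((a(j := Suc (a j)))(i := Suc ((a(j := Suc (a j))) i)))))"
  proof (subst sum.swap, intro sum.cong refl)
    fix i j
    have "(a(i := Suc (a i)))(j := Suc ((a(i := Suc (a i))) j)) =
        (a(j := Suc (a j)))(i := Suc ((a(j := Suc (a j))) i))"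
      by (auto simp: fun_eq_iff)
    then show "b i * (d j * g ((a(i := Suc (a i)))(j := Suc ((a(i := Suc (a i))) j)))) =
        d j * (b i * g ((a(j := Suc (a j)))(i := Suc ((a(j := Suc (a j))) i))))"
      by (simp only: mult.left_commute)
  qed
  also have "\<dots> = dird I d (dird I b g) a"
    by (simp add: dird_def sum_distrib_left del: fun_upd_apply)
  finally show "dird I b (dird I d g) a = dird I d (dird I b g) a" .
qed

lemma dird_scale: "dird I (\<lambda>i. s * b i) g a = s * dird I b g a"
  by (simp add: dird_def sum_distrib_left mult.assoc)

lemma dird_scale_right: "dird I b (\<lambda>a. s * g a) a = s * dird I b g a"
  by (simp add: dird_def sum_distrib_left mult.left_commute)

lemma funpow_dird_scale:
  "(dird I (\<lambda>i. s * b i) ^^ k) g = (\<lambda>a. s ^ k * (dird I b ^^ k) g a)"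
proof (induction k)
  case (Suc k)
  have "(dird I (\<lambda>i. s * b i) ^^ Suc k) g = dird I (\<lambda>i. s * b i) (\<lambda>a. s ^ k * (dird I b ^^ k) g a)"
    by (simp only: funpow.simps o_apply Suc)
  then show ?case
    unfolding dird_scale dird_scale_right by (simp add: mult_ac)
qed simp

lemma dird_of_real:
  "dird I (\<lambda>i. of_real (b i)) (\<lambda>a. of_real (g a)) =
     (\<lambda>a. of_real (dird I b g a) :: 'a::{real_algebra_1, comm_ring_1})"
  by (simp add: dird_def fun_eq_iff)

lemma funpow_dird_of_real:
  "(dird I (\<lambda>i. of_real (b i)) ^^ k) (\<lambda>a. of_real (g a)) =
     (\<lambda>a. of_real ((dird I b ^^ k) g a) :: 'a::{real_algebra_1, comm_ring_1})"
  by (induction k) (simp_all add: dird_of_real)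

lemma dird_nonneg:
  fixes g :: "(nat \<Rightarrow> nat) \<Rightarrow> real"
  assumes "\<And>i. i \<in> I \<Longrightarrow> b i \<ge> 0" "\<And>a. g a \<ge> 0"
  shows "dird I b g a \<ge> 0"
  using assms by (auto simp: dird_def intro!: sum_nonneg)

lemma funpow_dird_nonneg:
  fixes g :: "(nat \<Rightarrow> nat) \<Rightarrow> real"
  assumes "\<And>i. i \<in> I \<Longrightarrow> b i \<ge> 0" "\<And>a. g a \<ge> 0"
  shows "(dird I b ^^ k) g a \<ge> 0"
  using assms by (induction k arbitrary: a) (auto intro!: dird_nonneg)

text \<open>A function \<open>g\<close> on multi-indices encodes the homogeneous form
  \<open>\<Sum>\<^bsub>|a| = k\<^esub> g(a) y\<^sup>a / a!\<close>; directional derivatives become \<open>dird\<close>, and \<open>k!\<close> times the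
  value at \<open>y\<close> is obtained by differentiating \<open>k\<close> times along \<open>y\<close>.\<close>

definition form_value :: "nat set \<Rightarrow> nat \<Rightarrow> ((nat \<Rightarrow> nat) \<Rightarrow> 'a::comm_ring_1) \<Rightarrow> (nat \<Rightarrow> 'a) \<Rightarrow> 'a" where
  "form_value I k g y = (dird I y ^^ k) g (\<lambda>_. 0)"

lemma form_value_0 [simp]: "form_value I 0 g y = g (\<lambda>_. 0)"
  by (simp add: form_value_def)

lemma form_value_scale: "form_value I k g (\<lambda>i. s * y i) = s ^ k * form_value I k g y"
  by (simp add: form_value_def funpow_dird_scale)

lemma form_value_of_real:
  "form_value I k (\<lambda>a. of_real (g a)) (\<lambda>i. of_real (y i)) =
     (of_real (form_value I k g y) :: 'a::{real_algebra_1, comm_ring_1})"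
  by (simp add: form_value_def funpow_dird_of_real)

text \<open>The restriction of a form to the line \<open>y + t b\<close> as a polynomial in \<open>t\<close>.\<close>

fun line_poly ::
  "nat set \<Rightarrow> (nat \<Rightarrow> 'a::comm_ring_1) \<Rightarrow> (nat \<Rightarrow> 'a) \<Rightarrow> nat \<Rightarrow> ((nat \<Rightarrow> nat) \<Rightarrow> 'a) \<Rightarrow> (nat \<Rightarrow> nat) \<Rightarrow> 'a poly" where
  "line_poly I y b 0 g a = [:g a:]"
| "line_poly I y b (Suc k) g a =
     line_poly I y b k (dird I y g) a + pCons 0 (line_poly I y b k (dird I b g) a)"

lemma dird_line: "dird I (\<lambda>i. y i + t * b i) g = (\<lambda>a. dird I y g a + t * dird I b g a)"
  by (simp add: dird_def fun_eq_iff sum.distrib sum_distrib_left algebra_simps)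

lemma line_poly_linear:
  "line_poly I y b k (\<lambda>a. g a + t * h a) a = line_poly I y b k g a + smult t (line_poly I y b k h a)"
proof (induction k arbitrary: g h)
  case (Suc k)
  have "dird I d (\<lambda>a. g a + t * h a) = (\<lambda>a. dird I d g a + t * dird I d h a)" for d
    by (simp add: dird_def fun_eq_iff sum.distrib sum_distrib_left algebra_simps)
  then show ?case
    by (simp add: Suc smult_add_right)
qed simp

lemma poly_line_poly:
  "poly (line_poly I y b k g a) t = (dird I (\<lambda>i. y i + t * b i) ^^ k) g a"
proof (induction k arbitrary: g)
  case (Suc k)
  have "poly (line_poly I y b (Suc k) g a) t = poly (line_poly I y b k (dird I (\<lambda>i. y i + t * b i) g) a) t"
    by (simp add: dird_line line_poly_linear)
  then show ?case
    by (simp add: Suc funpow_Suc_right del: funpow.simps)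
qed simp

lemma coeff_line_poly_0: "coeff (line_poly I y b k g a) 0 = (dird I y ^^ k) g a"
  by (induction k arbitrary: g) (simp_all add: funpow_Suc_right del: funpow.simps)

text \<open>The factor \<open>Suc k\<close> comes from the normalisation: the restricted form
  carries (k+1)!, the derivative evaluated in degree k only k!.\<close>

lemma coeff_line_poly_1:
  "coeff (line_poly I y b (Suc k) g a) 1 = of_nat (Suc k) * (dird I y ^^ k) (dird I b g) a"
proof (induction k arbitrary: g)
  case (Suc k)
  have "coeff (line_poly I y b (Suc (Suc k)) g a) 1 =
     coeff (line_poly I y b (Suc k) (dird I y g) a) 1 + coeff (line_poly I y b (Suc k) (dird I b g) a) 0"
    by (subst line_poly.simps(2)) (simp only: coeff_add One_nat_def coeff_pCons_Suc)
  also have "\<dots> = of_nat (Suc k) * (dird I y ^^ k) (dird I b (dird I y g)) a + (dird I y ^^ Suc k) (dird I b g) a"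
    by (simp only: Suc coeff_line_poly_0)
  also have "(dird I y ^^ k) (dird I b (dird I y g)) = (dird I y ^^ Suc k) (dird I b g)"
    by (simp add: dird_commute[of I b y] funpow_Suc_right del: funpow.simps)
  finally show ?case
    by (simp add: algebra_simps)
qed simp

lemma degree_line_poly_le: "degree (line_poly I y b k g a) \<le> k"
proof (induction k arbitrary: g)
  case (Suc k)
  show ?case
    using Suc[of "dird I y g"] Suc[of "dird I b g"]
    by (auto intro!: degree_add_le intro: order.trans[OF degree_pCons_le])
qed simp

text \<open>The leading coefficient is the form at the direction \<open>b\<close> itself; for a
  stable form and positive \<open>b\<close> it is nonzero, so the restriction has full
  degree.\<close>

lemma coeff_line_poly_top: "coeff (line_poly I y b k g a) k = (dird I b ^^ k) g a"
proof (induction k arbitrary: g)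
  case (Suc k)
  have "coeff (line_poly I y b k (dird I y g) a) (Suc k) = 0"
    using degree_line_poly_le[of I y b k "dird I y g" a] by (simp add: coeff_eq_0)
  then show ?case
    by (simp add: Suc funpow_Suc_right del: funpow.simps)
qed simp

section \<open>Univariate polynomials with restricted roots, and Jensen's inequality\<close>

text \<open>The quotient is the logarithmic derivative at 0, which is the sum of -1/z over the roots
  z; each z, hence each 1/z, has negative real part.\<close>

lemma Re_coeff_1_div_coeff_0_pos:
  fixes p :: "complex poly"
  assumes "degree p > 0" and "\<And>z. Re z \<ge> 0 \<Longrightarrow> poly p z \<noteq> 0"
  shows "Re (coeff p 1 / coeff p 0) > 0"
  using assms
proof (induction "degree p" arbitrary: p)
  case (Suc k)
  obtain z where "poly p z = 0"
    using alg_closed_imp_poly_has_root Suc by blast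
  then obtain q where q: "p = [:-z, 1:] * q"
    by (metis dvdE poly_eq_0_iff_dvd)
  have z: "Re z < 0"
    using \<open>poly p z = 0\<close> Suc.prems(2)[of z] by linarith
  then have "z \<noteq> 0" by auto
  have "p \<noteq> 0" using Suc.prems by auto
  then have "degree q = k"
    using Suc(2) unfolding q by (subst (asm) degree_mult_eq) auto
  have nz: "poly q w \<noteq> 0" if "Re w \<ge> 0" for w
    using Suc.prems(2)[OF that] by (simp add: q)
  have q0: "coeff q 0 \<noteq> 0"
    using nz[of 0] by (simp add: poly_0_coeff_0)
  have "coeff p 1 / coeff p 0 = - 1 / z + coeff q 1 / coeff q 0"
    using q0 \<open>z \<noteq> 0\<close> by (simp add: q coeff_pCons field_simps)
  moreover have "Re (- 1 / z) > 0"
    using z \<open>z \<noteq> 0\<close> by (simp add: Re_divide divide_simps sum_power2_gt_zero_iff)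
  moreover have "Re (coeff q 1 / coeff q 0) \<ge> 0"
  proof (cases "degree q = 0")
    case True
    then show ?thesis by (simp add: coeff_eq_0)
  next
    case False
    then show ?thesis
      using Suc(1)[of q] nz \<open>degree q = k\<close> by auto
  qed
  ultimately show ?case by simp
qed simp

text \<open>Dividing by the constant term replaces the roots x by s = -1/x > 0, so that the sum of
  the s is the logarithmic derivative at 0, the quantity to be bounded below.\<close>

lemma negative_rooted_poly_split:
  fixes p :: "complex poly"
  assumes "\<And>z. poly p z = 0 \<Longrightarrow> z \<in> \<real> \<and> Re z < 0"
  shows "\<exists>s. (\<forall>k<degree p. s k > (0::real)) \<and>
    p = smult (coeff p 0) (\<Prod>k<degree p. [:1, of_real (s k):])"
  using assms
proof (induction "degree p" arbitrary: p)
  case 0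
  then show ?case
    by (metis degree_eq_zeroE coeff_pCons_0 lessThan_0 prod.empty less_nat_zero_code smult_one)
next
  case (Suc k)
  obtain z where z: "poly p z = 0"
    using alg_closed_imp_poly_has_root[of p] Suc(2) by auto
  then obtain q where q: "p = [:-z, 1:] * q"
    by (metis dvdE poly_eq_0_iff_dvd)
  obtain x where x: "z = of_real x" "x < 0"
    using Suc.prems[OF z] by (auto elim: Reals_cases)
  have "p \<noteq> 0" using Suc(2) by auto
  then have dq: "degree q = k"
    using Suc(2) unfolding q by (subst (asm) degree_mult_eq) auto
  have "\<And>z. poly q z = 0 \<Longrightarrow> z \<in> \<real> \<and> Re z < 0"
    using Suc.prems by (simp add: q)
  then obtain s where s: "\<forall>j<k. s j > (0::real)"
      "q = smult (coeff q 0) (\<Prod>j<k. [:1, of_real (s j):])"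
    using Suc(1)[of q] dq by auto
  let ?s = "s(k := - 1 / x)"
  have 0: "coeff p 0 = - z * coeff q 0"
    by (simp add: q)
  have lin: "[:-z, 1:] = smult (- z) [:1, of_real (- 1 / x):]"
    using x by simp
  have "p = smult (coeff p 0) ([:1, of_real (- 1 / x):] * (\<Prod>j<k. [:1, of_real (s j):]))"
    unfolding 0 by (subst q, subst lin, subst s(2)) (simp only: mult_smult_left mult_smult_right smult_smult mult.commute)
  also have "[:1, of_real (- 1 / x):] * (\<Prod>j<k. [:1, of_real (s j):]) =
      (\<Prod>j<Suc k. [:1, of_real (?s j):])"
    by (simp add: mult_ac)
  finally have "p = smult (coeff p 0) (\<Prod>j<degree p. [:1, of_real (?s j):])"
    by (simp add: Suc(2))
  moreover have "\<forall>j<degree p. ?s j > 0"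
    using s(1) x by (auto simp: Suc(2)[symmetric] less_Suc_eq)
  ultimately show ?case by blast
qed

text \<open>Jensen's inequality for the logarithm, from \<open>ln x \<le> x - 1\<close> applied to
  each argument divided by the weighted mean. It serves three times: for the roots, for the capacity
  of the monomial and for the scaling inequality.\<close>

lemma weighted_ln_le_ln_weighted:
  fixes w x :: "'i \<Rightarrow> real"
  assumes "finite S" and w: "\<And>i. i \<in> S \<Longrightarrow> w i \<ge> 0" "sum w S = 1" and x: "\<And>i. i \<in> S \<Longrightarrow> x i > 0"
  shows "(\<Sum>i\<in>S. w i * ln (x i)) \<le> ln (\<Sum>i\<in>S. w i * x i)"
proof -
  define s where "s = (\<Sum>i\<in>S. w i * x i)"
  obtain i where "i \<in> S" "w i > 0"
    using w by (metis less_eq_real_def sum.neutral zero_neq_one)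
  then have s: "s > 0"
    unfolding s_def using assms by (intro sum_pos2[of S i]) (auto simp: less_imp_le)
  have "w i * (ln (x i) - ln s) \<le> w i * (x i / s - 1)" if "i \<in> S" for i
    using w(1)[OF that] x[OF that] s ln_le_minus_one[of "x i / s"]
    by (intro mult_left_mono) (simp_all add: ln_div)
  then have "(\<Sum>i\<in>S. w i * (ln (x i) - ln s)) \<le> (\<Sum>i\<in>S. w i * (x i / s - 1))"
    by (rule sum_mono)
  also have "\<dots> = s / s - 1"
    by (simp add: right_diff_distrib sum_subtractf w(2) flip: sum_divide_distrib s_def)
  finally show ?thesis
    using s by (simp add: right_diff_distrib sum_subtractf w(2) s_def flip: sum_distrib_right)
qed

section \<open>Stable forms and capacity\<close>

text \<open>The right half plane contains the positive reals, so positive points are nonzeros and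
  moving along positive directions stays inside. By homogeneity any open half plane bounded by a
  line through 0 gives the same notion.\<close>

definition stable_form :: "nat set \<Rightarrow> nat \<Rightarrow> ((nat \<Rightarrow> nat) \<Rightarrow> complex) \<Rightarrow> bool" where
  "stable_form I k g \<longleftrightarrow> (\<forall>y. (\<forall>i\<in>I. Re (y i) > 0) \<longrightarrow> form_value I k g y \<noteq> 0)"

text \<open>A Gauss-Lucas argument on one line: f(y + t b) has no zero with Re t \<ge> 0, so its
  logarithmic derivative at t = 0 has positive real part, and the linear coefficient, a multiple of
  the derivative at y, cannot vanish.\<close>

lemma stable_form_dird:
  assumes g: "stable_form I (Suc k) g" and b: "\<And>i. i \<in> I \<Longrightarrow> b i > (0::real)"
  shows "stable_form I k (dird I (\<lambda>i. of_real (b i)) g)"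
  unfolding stable_form_def
proof (intro allI impI)
  fix y assume y: "\<forall>i\<in>I. Re (y i) > 0"
  let ?b = "\<lambda>i. complex_of_real (b i)"
  let ?p = "line_poly I y ?b (Suc k) g (\<lambda>_. 0)"
  have "coeff ?p (Suc k) \<noteq> 0"
    unfolding coeff_line_poly_top using g b by (simp add: stable_form_def form_value_def)
  then have "degree ?p > 0"
    by (rule order.strict_trans2[OF zero_less_Suc le_degree])
  moreover have "poly ?p t \<noteq> 0" if "Re t \<ge> 0" for t
    unfolding poly_line_poly form_value_def[symmetric]
    using g b y that by (auto simp: stable_form_def add_pos_nonneg less_imp_le)
  ultimately have "Re (coeff ?p 1 / coeff ?p 0) > 0"
    by (rule Re_coeff_1_div_coeff_0_pos)
  then have "coeff ?p 1 \<noteq> 0"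
    by auto
  then show "form_value I k (dird I ?b g) y \<noteq> 0"
    unfolding coeff_line_poly_1 form_value_def by simp
qed

text \<open>Homogeneity lets one rotate any direction with imaginary parts of one sign into the right
  half space; this is why stable forms are real rooted along positive lines.\<close>

lemma stable_form_line_roots:
  assumes g: "stable_form I k g" and "I \<noteq> {}"
    and b: "\<And>i. i \<in> I \<Longrightarrow> b i > (0::real)" and y: "\<And>i. i \<in> I \<Longrightarrow> y i > (0::real)"
    and t: "form_value I k g (\<lambda>i. of_real (y i) + t * of_real (b i)) = 0"
  shows "t \<in> \<real> \<and> Re t < 0"
proof -
  have "Im t = 0"
  proof (rule ccontr)
    assume "Im t \<noteq> 0"
    define u where "u = (if Im t > 0 then - \<i> else \<i>)"
    have "Re (u * (of_real (y i) + t * of_real (b i))) > 0" if "i \<in> I" for i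
      using b[OF that] \<open>Im t \<noteq> 0\<close> by (auto simp: u_def mult_neg_pos not_less)
    then have "form_value I k g (\<lambda>i. u * (of_real (y i) + t * of_real (b i))) \<noteq> 0"
      using g by (auto simp: stable_form_def)
    with t show False
      by (simp add: form_value_scale)
  qed
  moreover have "Re t < 0"
  proof (rule ccontr)
    assume "\<not> Re t < 0"
    then have "\<And>i. i \<in> I \<Longrightarrow> Re (of_real (y i) + t * of_real (b i)) > 0"
      using b y by (auto intro!: add_pos_nonneg mult_nonneg_nonneg simp: less_imp_le)
    with t g show False
      by (auto simp: stable_form_def)
  qed
  ultimately show ?thesis
    by (simp add: complex_is_Real_iff)
qed

lemma prod_one_plus_le_power:
  fixes s :: "nat \<Rightarrow> real"
  assumes "\<And>k. k < K \<Longrightarrow> s k > 0" "t > 0" "K > 0"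
  shows "(\<Prod>k<K. 1 + t * s k) \<le> (1 + t * sum s {..<K} / K) ^ K"
proof -
  have pos: "1 + t * s k > 0" if "k < K" for k
    using assms that by (simp add: add_pos_pos)
  have "(\<Sum>k<K. 1 / K * ln (1 + t * s k)) \<le> ln (\<Sum>k<K. 1 / K * (1 + t * s k))"
    using assms pos by (intro weighted_ln_le_ln_weighted) auto
  also have "(\<Sum>k<K. 1 / K * (1 + t * s k)) = 1 + t * sum s {..<K} / K"
    using \<open>K > 0\<close> by (simp add: add_divide_distrib sum.distrib sum_distrib_left sum_divide_distrib)
  finally have "ln (\<Prod>k<K. 1 + t * s k) \<le> K * ln (1 + t * sum s {..<K} / K)"
    using \<open>K > 0\<close> ln_prod[of "{..<K}" "\<lambda>k. 1 + t * s k"] pos[THEN less_imp_neq]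
    by (force simp: pos_divide_le_eq mult.commute simp flip: sum_divide_distrib)
  moreover have "1 + t * sum s {..<K} / K > 0"
    using assms by (intro add_pos_nonneg divide_nonneg_pos mult_nonneg_nonneg sum_nonneg) (auto simp: less_imp_le)
  ultimately show ?thesis
    using pos by (subst ln_le_cancel_iff[symmetric]) (auto intro!: prod_pos simp: ln_realpow)
qed

text \<open>Since the restriction has negative roots, f(y + t b) is f(y) times the product of the 1
  + t s_j, and the left side of the claim is f(y) S with S the sum of the s_j. Bounding the product
  by (1 + t S / K)^K and comparing with L t gives f(y) S \<ge> L t S / (1 + t S / K)^K for every t >
  0.\<close>

lemma stable_form_derivative_bound:
  fixes g :: "(nat \<Rightarrow> nat) \<Rightarrow> real"
  assumes g: "stable_form I (Suc (Suc k)) (\<lambda>a. of_real (g a))" and pos: "\<And>a. g a \<ge> 0" and "I \<noteq> {}"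
    and b: "\<And>i. i \<in> I \<Longrightarrow> b i > (0::real)" and y: "\<And>i. i \<in> I \<Longrightarrow> y i > (0::real)"
    and lb: "\<And>t. t > 0 \<Longrightarrow> form_value I (Suc (Suc k)) g (\<lambda>i. y i + t * b i) \<ge> L * t"
  shows "real (Suc (Suc k)) * form_value I (Suc k) (dird I b g) y \<ge>
    (real (Suc k) / real (Suc (Suc k))) ^ Suc k * L"
proof -
  let ?K = "Suc (Suc k)"
  let ?y = "\<lambda>i. complex_of_real (y i)" and ?b = "\<lambda>i. complex_of_real (b i)"
    and ?g = "\<lambda>a. complex_of_real (g a)"
  let ?p = "line_poly I ?y ?b ?K ?g (\<lambda>_. 0)"
  have "coeff ?p ?K \<noteq> 0"
    unfolding coeff_line_poly_top using g b by (simp add: stable_form_def form_value_def)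
  then have deg: "degree ?p = ?K"
    using degree_line_poly_le le_degree le_antisym by metis
  have c0: "coeff ?p 0 = of_real (form_value I ?K g y)"
    unfolding coeff_line_poly_0 form_value_of_real[symmetric] by (simp add: form_value_def)
  have c1: "coeff ?p 1 = of_real (real ?K * form_value I (Suc k) (dird I b g) y)"
    unfolding coeff_line_poly_1 dird_of_real funpow_dird_of_real by (simp add: form_value_def)
  have ev: "poly ?p (of_real t) = of_real (form_value I ?K g (\<lambda>i. y i + t * b i))" for t
    unfolding poly_line_poly form_value_of_real[symmetric] by (simp add: form_value_def)
  have "\<And>z. poly ?p z = 0 \<Longrightarrow> z \<in> \<real> \<and> Re z < 0"
    unfolding poly_line_poly form_value_def[symmetric]
    by (rule stable_form_line_roots[OF g \<open>I \<noteq> {}\<close> b y])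
  then obtain s where s: "\<And>j. j < ?K \<Longrightarrow> s j > (0::real)"
      "?p = smult (coeff ?p 0) (\<Prod>j<?K. [:1, of_real (s j):])"
    using negative_rooted_poly_split[of ?p] unfolding deg by blast
  define S where "S = sum s {..<?K}"
  have "S > 0"
    unfolding S_def using s(1) by (intro sum_pos) auto
  define f where "f = form_value I ?K g y"
  have "complex_of_real f \<noteq> 0"
    using g y unfolding f_def form_value_of_real[symmetric] stable_form_def by simp
  then have "f \<noteq> 0" by simp
  moreover have "f \<ge> 0"
    unfolding f_def form_value_def using pos y by (intro funpow_dird_nonneg) (auto simp: less_imp_le)
  ultimately have "f > 0" by simp
  have val: "form_value I ?K g (\<lambda>i. y i + t * b i) = f * (\<Prod>j<?K. 1 + t * s j)" for t
  proof -
    have "complex_of_real (form_value I ?K g (\<lambda>i. y i + t * b i)) =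
        poly (smult (coeff ?p 0) (\<Prod>j<?K. [:1, of_real (s j):])) (of_real t)"
      unfolding ev[symmetric] s(2)[symmetric] ..
    also have "\<dots> = of_real (f * (\<Prod>j<?K. 1 + t * s j))"
      unfolding c0 f_def[symmetric] by (simp add: poly_prod del: prod.lessThan_Suc)
    finally show ?thesis
      by (simp only: of_real_eq_iff)
  qed
  have coeff1: "coeff (\<Prod>j<n. [:1, complex_of_real (s j):]) 0 = 1 \<and>
      coeff (\<Prod>j<n. [:1, complex_of_real (s j):]) 1 = of_real (sum s {..<n})" for n
    by (induction n) (auto simp: coeff_mult)
  have "coeff ?p 1 = coeff (smult (coeff ?p 0) (\<Prod>j<?K. [:1, of_real (s j):])) 1"
    by (rule arg_cong[OF s(2)])
  then have "coeff ?p 1 = coeff ?p 0 * of_real S"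
    unfolding coeff_smult coeff1[THEN conjunct2] S_def .
  then have d: "real ?K * form_value I (Suc k) (dird I b g) y = f * S"
    unfolding c0 c1 f_def[symmetric] of_real_mult[symmetric] of_real_eq_iff .
  \<comment> \<open>This t maximises t S / (1 + t S / K)^K for K = \<open>?K\<close>, the maximum
    being ((K-1) / K)^(K-1). Degree at least two keeps K - 1 positive.\<close>
  define t where "t = ?K / (S * Suc k)"
  have "t > 0" using \<open>S > 0\<close> by (simp add: t_def)
  have "L * t \<le> f * (\<Prod>j<?K. 1 + t * s j)"
    using lb[OF \<open>t > 0\<close>] by (simp only: val)
  also have "\<dots> \<le> f * (1 + t * S / ?K) ^ ?K"
    unfolding S_def using s(1) \<open>f > 0\<close> \<open>t > 0\<close> by (intro mult_left_mono prod_one_plus_le_power) auto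
  also have "t * S / ?K = 1 / Suc k"
    using \<open>S > 0\<close> by (simp add: t_def del: of_nat_Suc)
  also have "1 + 1 / real (Suc k) = ?K / Suc k"
    by (simp add: field_simps)
  finally have "L * t * (Suc k / ?K) ^ ?K \<le> f * (?K / Suc k) ^ ?K * (Suc k / ?K) ^ ?K"
    by (intro mult_right_mono) auto
  also have "\<dots> = f"
    by (simp add: power_divide del: power_Suc of_nat_Suc)
  finally have "(L * t * (Suc k / ?K) ^ ?K) * S \<le> f * S"
    using \<open>S > 0\<close> by (intro mult_right_mono) simp_all
  also have "(L * t * (Suc k / ?K) ^ ?K) * S = (Suc k / ?K) ^ Suc k * L"
    using \<open>S > 0\<close> unfolding power_Suc[of _ "Suc k"]
    by (simp add: t_def field_simps del: power_Suc of_nat_Suc)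
  finally show ?thesis
    unfolding d .
qed

text \<open>Gurvits' polynomial in \<alpha> is the form at the combination of the columns with
  coefficients \<alpha>, and \<open>L\<close> bounds its capacity from below. Differentiating in one
  variable and setting it to 0 amounts to \<open>dird\<close> along that column, so the induction
  stays with forms in the variables \<open>I\<close>. The new constant L k^k / (k+1)^(k+1) is what
  telescopes.\<close>

lemma form_value_capacity_bound:
  fixes g :: "(nat \<Rightarrow> nat) \<Rightarrow> real"
  assumes "stable_form I (length bs) (\<lambda>a. of_real (g a))" and "\<And>a. g a \<ge> 0" and "I \<noteq> {}"
    and "\<And>b i. b \<in> set bs \<Longrightarrow> i \<in> I \<Longrightarrow> b i > (0::real)"
    and "\<And>\<alpha>. (\<And>l. \<alpha> l > 0) \<Longrightarrow>
      form_value I (length bs) g (\<lambda>i. \<Sum>l<length bs. \<alpha> l * (bs ! l) i) \<ge> L * (\<Prod>l<length bs. \<alpha> l)"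
  shows "fold (dird I) bs g (\<lambda>_. 0) \<ge> L / real (length bs) ^ length bs"
  using assms
proof (induction bs arbitrary: g L)
  case Nil
  from Nil.prems(5)[of "\<lambda>_. 1"] show ?case by simp
next
  case (Cons b bs)
  let ?k = "length bs"
  define g' where "g' = dird I b g"
  have bpos: "\<And>i. i \<in> I \<Longrightarrow> b i > 0"
    using Cons.prems(4) by auto
  have g': "g' a \<ge> 0" for a
    unfolding g'_def using bpos Cons.prems(2) by (intro dird_nonneg) (auto simp: less_imp_le)
  have split: "form_value I (Suc ?k) g (\<lambda>i. (\<Sum>l<?k. \<alpha> l * (bs ! l) i) + t * b i) \<ge>
      L * (\<Prod>l<?k. \<alpha> l) * t" if "\<And>l. \<alpha> l > 0" "t > 0" for \<alpha> t
  proof -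
    \<comment> \<open>The head of the list has index 0, so its coefficient t is put in front of the
      others.\<close>
    let ?\<alpha> = "case_nat t \<alpha>"
    have "?\<alpha> l > 0" for l
      using that by (cases l) auto
    from Cons.prems(5)[of ?\<alpha>, OF this] show ?thesis
      by (simp add: prod.lessThan_Suc_shift sum.lessThan_Suc_shift mult_ac add_ac del: prod.lessThan_Suc sum.lessThan_Suc)
  qed
  have *: "form_value I ?k g' (\<lambda>i. \<Sum>l<?k. \<alpha> l * (bs ! l) i) \<ge>
       L * real ?k ^ ?k / real (Suc ?k) ^ Suc ?k * (\<Prod>l<?k. \<alpha> l)" if \<alpha>: "\<And>l. \<alpha> l > 0" for \<alpha>
  proof (cases bs)
    \<comment> \<open>In degree one the form is linear: its value at \<open>b\<close> already is the
      derivative, and the lost factor is 0^0 / 1^1 = 1.\<close>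
    case Nil
    have "form_value I 1 g b \<ge> L"
      using split[of \<alpha> 1] \<alpha> Nil by simp
    then show ?thesis
      using Nil by (simp add: form_value_def g'_def)
  next
    case (Cons b1 bs1)
    have y: "(\<Sum>l<?k. \<alpha> l * (bs ! l) i) > 0" if "i \<in> I" for i
      using Cons that \<alpha> Cons.prems(4) nth_mem[of _ bs] by (intro sum_pos mult_pos_pos) auto
    obtain k where k: "?k = Suc k"
      using Cons by simp
    have "real (Suc ?k) * form_value I ?k g' (\<lambda>i. \<Sum>l<?k. \<alpha> l * (bs ! l) i) \<ge>
        (real ?k / real (Suc ?k)) ^ ?k * (L * (\<Prod>l<?k. \<alpha> l))"
      unfolding g'_def k
      by (rule stable_form_derivative_bound)
        (use Cons.prems(1-3) bpos y split[of \<alpha>] \<alpha> in \<open>simp_all add: k del: sum.lessThan_Suc prod.lessThan_Suc\<close>)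
    then show ?thesis
      by (simp add: field_simps power_divide del: of_nat_Suc)
  qed
  have "stable_form I ?k (\<lambda>a. of_real (g' a))"
    using stable_form_dird[of I ?k "\<lambda>a. of_real (g a)" b] Cons.prems(1) bpos
    by (simp add: g'_def dird_of_real)
  then have "fold (dird I) bs g' (\<lambda>_. 0) \<ge> L * real ?k ^ ?k / real (Suc ?k) ^ Suc ?k / real ?k ^ ?k"
    using g' Cons.prems(3,4) * by (intro Cons.IH) auto
  then show ?case
    by (cases bs) (simp_all add: g'_def)
qed

section \<open>Iterated derivatives and tables\<close>

definition multi_indices :: "nat set \<Rightarrow> nat \<Rightarrow> (nat \<Rightarrow> nat) set" where
  "multi_indices I k = {a. (\<forall>i. i \<notin> I \<longrightarrow> a i = 0) \<and> sum a I = k}"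

lemma finite_multi_indices:
  assumes "finite I"
  shows "finite (multi_indices I k)"
proof (rule finite_subset)
  show "multi_indices I k \<subseteq> {f. \<forall>i. (i \<in> I \<longrightarrow> f i \<in> {..k}) \<and> (i \<notin> I \<longrightarrow> f i = 0)}"
    using assms by (auto simp: multi_indices_def intro!: member_le_sum)
  show "finite {f. \<forall>i. (i \<in> I \<longrightarrow> f i \<in> {..k}) \<and> (i \<notin> I \<longrightarrow> f i = (0::nat))}"
    using assms by (intro finite_set_of_finite_funs) auto
qed

text \<open>Raising the i-th entry is a bijection onto the indices whose i-th entry is positive; on
  all others \<open>F\<close> vanishes. This absorbs the index shift in the multinomial
  expansion.\<close>

lemma sum_multi_indices_Suc:
  fixes F :: "(nat \<Rightarrow> nat) \<Rightarrow> 'a::comm_monoid_add"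
  assumes "finite I" "i \<in> I" and F: "\<And>d. d i = 0 \<Longrightarrow> F d = 0"
  shows "(\<Sum>d\<in>multi_indices I k. F (d(i := Suc (d i)))) = (\<Sum>d\<in>multi_indices I (Suc k). F d)"
proof -
  have shift: "sum (d(i := x)) I + d i = sum d I + x" for d :: "nat \<Rightarrow> nat" and x
    using assms(1,2) by (simp add: sum.remove[of I i])
  have "(\<Sum>d\<in>multi_indices I k. F (d(i := Suc (d i)))) =
      (\<Sum>d\<in>{d \<in> multi_indices I (Suc k). d i > 0}. F d)"
  proof (rule sum.reindex_bij_witness[where i = "\<lambda>d. d(i := d i - 1)" and j = "\<lambda>d. d(i := Suc (d i))"])
    fix d assume d: "d \<in> multi_indices I k"
    then show "d(i := Suc (d i)) \<in> {d \<in> multi_indices I (Suc k). d i > 0}"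
      using assms(2) shift[of d "Suc (d i)"] by (auto simp: multi_indices_def)
  next
    fix d assume d: "d \<in> {d \<in> multi_indices I (Suc k). d i > 0}"
    then show "d(i := d i - 1) \<in> multi_indices I k"
      using assms(2) shift[of d "d i - 1"] by (auto simp: multi_indices_def)
  qed auto
  also have "\<dots> = (\<Sum>d\<in>multi_indices I (Suc k). F d)"
    using F by (intro sum.mono_neutral_left finite_multi_indices assms(1)) auto
  finally show ?thesis .
qed

text \<open>One more derivative produces the index d with weight d_i from each i; these weights add
  up to k + 1, which turns k! into (k+1)!.\<close>

lemma funpow_dird_multinomial:
  fixes b :: "nat \<Rightarrow> 'a::field_char_0"
  assumes "finite I"
  shows "(dird I b ^^ k) g a =
    (\<Sum>d\<in>multi_indices I k. fact k * (\<Prod>i\<in>I. b i ^ d i / fact (d i)) * g (\<lambda>i. a i + d i))"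
proof (induction k arbitrary: a)
  case 0
  have "multi_indices I 0 = {\<lambda>_. 0}"
    using assms by (auto simp: multi_indices_def)
  then show ?case by simp
next
  case (Suc k)
  define w where "w d = (\<Prod>i\<in>I. b i ^ d i / fact (d i))" for d
  have w: "b i * w d = of_nat (Suc (d i)) * w (d(i := Suc (d i)))" if "i \<in> I" for i d
  proof -
    have "w d = b i ^ d i / fact (d i) * (\<Prod>j\<in>I - {i}. b j ^ d j / fact (d j))"
      and "w (d(i := Suc (d i))) =
        b i ^ Suc (d i) / fact (Suc (d i)) * (\<Prod>j\<in>I - {i}. b j ^ d j / fact (d j))"
      unfolding w_def using assms that by (simp_all add: prod.remove[of I i] cong: prod.cong_simp)
    moreover have "fact (d i) \<noteq> (0::'a)" "of_nat (Suc (d i)) \<noteq> (0::'a)"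
      by (simp_all del: of_nat_Suc)
    ultimately show ?thesis
      by (simp only: fact_Suc power_Suc times_divide_eq_left times_divide_eq_right mult_ac
          mult_divide_mult_cancel_left of_nat_mult) (simp add: mult_ac del: of_nat_Suc)
  qed
  have "(dird I b ^^ Suc k) g a = dird I b ((dird I b ^^ k) g) a"
    by simp
  also have "\<dots> = (\<Sum>i\<in>I. \<Sum>d\<in>multi_indices I k.
      fact k * (of_nat (Suc (d i)) * w (d(i := Suc (d i)))) * g (\<lambda>j. a j + (d(i := Suc (d i))) j))"
    unfolding dird_def Suc w_def[symmetric] sum_distrib_left
  proof (intro sum.cong refl)
    fix i d assume "i \<in> I"
    have "(\<lambda>j. (a(i := Suc (a i))) j + d j) = (\<lambda>j. a j + (d(i := Suc (d i))) j)"
      by auto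
    then show "b i * (fact k * w d * g (\<lambda>j. (a(i := Suc (a i))) j + d j)) =
        fact k * (of_nat (Suc (d i)) * w (d(i := Suc (d i)))) * g (\<lambda>j. a j + (d(i := Suc (d i))) j)"
      unfolding w[OF \<open>i \<in> I\<close>, symmetric] by simp
  qed
  also have "\<dots> = (\<Sum>i\<in>I. \<Sum>d\<in>multi_indices I (Suc k).
      fact k * (of_nat (d i) * w d) * g (\<lambda>j. a j + d j))"
  proof (rule sum.cong[OF refl])
    fix i assume "i \<in> I"
    show "(\<Sum>d\<in>multi_indices I k.
        fact k * (of_nat (Suc (d i)) * w (d(i := Suc (d i)))) * g (\<lambda>j. a j + (d(i := Suc (d i))) j)) =
      (\<Sum>d\<in>multi_indices I (Suc k). fact k * (of_nat (d i) * w d) * g (\<lambda>j. a j + d j))"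
      using sum_multi_indices_Suc[OF assms \<open>i \<in> I\<close>,
          of "\<lambda>d. fact k * (of_nat (d i) * w d) * g (\<lambda>j. a j + d j)" k]
      by simp
  qed
  also have "\<dots> = (\<Sum>d\<in>multi_indices I (Suc k). \<Sum>i\<in>I. fact k * (of_nat (d i) * w d) * g (\<lambda>j. a j + d j))"
    by (rule sum.swap)
  also have "\<dots> = (\<Sum>d\<in>multi_indices I (Suc k). fact (Suc k) * w d * g (\<lambda>j. a j + d j))"
  proof (rule sum.cong[OF refl])
    fix d assume "d \<in> multi_indices I (Suc k)"
    then have "(\<Sum>i\<in>I. of_nat (d i) :: 'a) = of_nat (Suc k)"
      by (simp add: multi_indices_def flip: of_nat_sum)
    moreover have "(\<Sum>i\<in>I. fact k * (of_nat (d i) * w d) * g (\<lambda>j. a j + d j)) =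
        fact k * (\<Sum>i\<in>I. of_nat (d i)) * w d * g (\<lambda>j. a j + d j)"
      by (simp add: sum_distrib_left sum_distrib_right mult_ac)
    ultimately show "(\<Sum>i\<in>I. fact k * (of_nat (d i) * w d) * g (\<lambda>j. a j + d j)) =
        fact (Suc k) * w d * g (\<lambda>j. a j + d j)"
      by (simp add: mult.commute)
  qed
  finally show ?case
    unfolding w_def .
qed

section \<open>Differentiation along repeated columns as a sum over tables\<close>

definition column_list :: "nat \<Rightarrow> (nat \<Rightarrow> nat) \<Rightarrow> (nat \<Rightarrow> 'a) \<Rightarrow> 'a list" where
  "column_list n c b = concat (map (\<lambda>j. replicate (c j) (b j)) [1..<Suc n])"

lemma column_list_0 [simp]: "column_list 0 c b = []"
  by (simp add: column_list_def)

lemma column_list_Suc [simp]: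
  "column_list (Suc n) c b = column_list n c b @ replicate (c (Suc n)) (b (Suc n))"
  by (simp add: column_list_def)

lemma length_column_list: "length (column_list n c b) = (\<Sum>j=1..n. c j)"
  by (induction n) simp_all

lemma set_column_list: "set (column_list n c b) \<subseteq> b ` {1..n}"
  by (auto simp: column_list_def split: if_splits)

lemma sum_list_column_list:
  fixes f :: "'a \<Rightarrow> 'b::comm_semiring_1"
  shows "(\<Sum>x\<leftarrow>column_list n c b. f x) = (\<Sum>j=1..n. of_nat (c j) * f (b j))"
  by (induction n) (simp_all add: sum_list_replicate)

lemma fold_replicate_funpow: "fold f (replicate k x) = f x ^^ k"
  by (induction k) (simp_all add: funpow_Suc_right del: funpow.simps)

text \<open>Row sums are left free: they are recorded in the index at which \<open>g\<close> is
  evaluated, and the monomial later selects the required ones.\<close>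

definition column_tables :: "nat set \<Rightarrow> nat \<Rightarrow> (nat \<Rightarrow> nat) \<Rightarrow> (nat \<Rightarrow> nat \<Rightarrow> nat) set" where
  "column_tables I n c = {D. (\<forall>i j. i \<notin> I \<or> j \<notin> {1..n} \<longrightarrow> D i j = 0) \<and> (\<forall>j\<in>{1..n}. (\<Sum>i\<in>I. D i j) = c j)}"

lemma fold_dird_column_list:
  fixes b :: "nat \<Rightarrow> nat \<Rightarrow> 'a::field_char_0"
  assumes "finite I"
  shows "fold (dird I) (column_list n c b) g a =
    (\<Sum>D\<in>column_tables I n c.
       (\<Prod>j=1..n. fact (c j) * (\<Prod>i\<in>I. b j i ^ D i j / fact (D i j))) * g (\<lambda>i. a i + (\<Sum>j=1..n. D i j)))"
proof (induction n arbitrary: a)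
  case 0
  have "column_tables I 0 c = {\<lambda>_ _. 0}"
    by (auto simp: column_tables_def)
  then show ?case by simp
next
  case (Suc n)
  define W where "W n D = (\<Prod>j=1..n. fact (c j) * (\<Prod>i\<in>I. b j i ^ D i j / fact (D i j)))" for n D
  define w where "w d = fact (c (Suc n)) * (\<Prod>i\<in>I. b (Suc n) i ^ d i / fact (d i))" for d
  let ?S = "\<lambda>n D i. \<Sum>j=1..n. D i j"
  define F where "F D = W (Suc n) D * g (\<lambda>i. a i + ?S (Suc n) D i)" for D
  \<comment> \<open>Glues a last column onto a table with n columns, a bijection from pairs to
    tables with n + 1 columns.\<close>
  define ext where "ext p = (\<lambda>i j. if j = Suc n then fst p i else snd p i j)"
    for p :: "(nat \<Rightarrow> nat) \<times> (nat \<Rightarrow> nat \<Rightarrow> nat)"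
  let ?P = "multi_indices I (c (Suc n)) \<times> column_tables I n c"
  have "fold (dird I) (column_list (Suc n) c b) g a =
      (dird I (b (Suc n)) ^^ c (Suc n)) (fold (dird I) (column_list n c b) g) a"
    by (simp add: fold_replicate_funpow)
  also have "\<dots> = (\<Sum>d\<in>multi_indices I (c (Suc n)). w d *
      (\<Sum>D\<in>column_tables I n c. W n D * g (\<lambda>i. a i + d i + ?S n D i)))"
    unfolding funpow_dird_multinomial[OF assms] Suc W_def w_def ..
  also have "\<dots> = (\<Sum>p\<in>?P. w (fst p) * (W n (snd p) * g (\<lambda>i. a i + fst p i + ?S n (snd p) i)))"
    unfolding sum_distrib_left sum.cartesian_product by (simp add: case_prod_beta)
  also have "\<dots> = (\<Sum>p\<in>?P. F (ext p))"
  proof (rule sum.cong[OF refl])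
    fix p
    have "W n (ext p) = W n (snd p)"
      unfolding W_def ext_def by (intro prod.cong refl arg_cong2[of _ _ _ _ "(*)"]) auto
    moreover have "W (Suc n) (ext p) = W n (ext p) * w (fst p)"
      by (simp add: W_def w_def ext_def)
    moreover have "?S (Suc n) (ext p) i = ?S n (snd p) i + fst p i" for i
    proof -
      have "?S n (ext p) i = ?S n (snd p) i"
        by (intro sum.cong) (auto simp: ext_def)
      then show ?thesis by (simp add: ext_def)
    qed
    ultimately show "w (fst p) * (W n (snd p) * g (\<lambda>i. a i + fst p i + ?S n (snd p) i)) = F (ext p)"
      unfolding F_def by (simp only: add_ac mult_ac)
  qed
  also have "\<dots> = (\<Sum>D\<in>column_tables I (Suc n) c. F D)"
  proof (rule sum.reindex_bij_witness[where j = ext and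
        i = "\<lambda>D. (\<lambda>i. D i (Suc n), \<lambda>i j. if j = Suc n then 0 else D i j)"])
    fix p assume p: "p \<in> ?P"
    then have "snd p i (Suc n) = 0" for i
      by (auto simp: column_tables_def)
    then show "(\<lambda>i. ext p i (Suc n), \<lambda>i j. if j = Suc n then 0 else ext p i j) = p"
      by (auto simp: ext_def prod_eq_iff fun_eq_iff)
    have "(\<Sum>i\<in>I. ext p i j) = c j" if "j \<in> {1..Suc n}" for j
      using p that by (cases "j = Suc n") (auto simp: ext_def column_tables_def multi_indices_def)
    then show "ext p \<in> column_tables I (Suc n) c"
      using p by (auto simp: column_tables_def multi_indices_def ext_def)
  next
    fix D assume D: "D \<in> column_tables I (Suc n) c"
    show "ext (\<lambda>i. D i (Suc n), \<lambda>i j. if j = Suc n then 0 else D i j) = D"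
      by (auto simp: ext_def fun_eq_iff)
    show "(\<lambda>i. D i (Suc n), \<lambda>i j. if j = Suc n then 0 else D i j) \<in> ?P"
      using D by (auto simp: column_tables_def multi_indices_def)
  qed auto
  finally show ?case
    unfolding F_def W_def .
qed

section \<open>Bounds for doubly stochastic block matrices\<close>

lemma finite_column_tables:
  assumes "finite I"
  shows "finite (column_tables I n c)"
proof (rule finite_subset)
  let ?F = "{f. \<forall>j. (j \<in> {1..n} \<longrightarrow> f j \<in> (\<Union>j\<in>{1..n}. multi_indices I (c j))) \<and>
    (j \<notin> {1..n} \<longrightarrow> f j = (\<lambda>_. 0))}"
  show "column_tables I n c \<subseteq> (\<lambda>f i j. f j i) ` ?F"
  proof
    fix D assume "D \<in> column_tables I n c"
    then have "(\<lambda>j i. D i j) \<in> ?F"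
      by (auto simp: column_tables_def multi_indices_def)
    then show "D \<in> (\<lambda>f i j. f j i) ` ?F"
      by (rule rev_image_eqI) simp
  qed
  show "finite ((\<lambda>f i j. f j i) ` ?F)"
    using assms by (intro finite_imageI finite_set_of_finite_funs finite_UN_I finite_multi_indices) auto
qed

definition table_sum :: "nat \<Rightarrow> nat \<Rightarrow> (nat \<Rightarrow> nat) \<Rightarrow> (nat \<Rightarrow> nat) \<Rightarrow> (nat \<Rightarrow> nat \<Rightarrow> real) \<Rightarrow> real" where
  "table_sum m n r c V =
     (\<Sum>D\<in>contingency_tables m n r c. \<Prod>i=1..m. \<Prod>j=1..n. V i j ^ D i j / fact (D i j))"

text \<open>The coefficient function of the monomial \<open>y\<^sup>r = \<Prod>\<^sub>i y\<^sub>i\<^bsup>r i\<^esup>\<close> divided by \<open>\<Prod>\<^sub>i r\<^sub>i!\<close>.\<close>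

definition monomial_coeff :: "nat \<Rightarrow> (nat \<Rightarrow> nat) \<Rightarrow> (nat \<Rightarrow> nat) \<Rightarrow> 'a::comm_ring_1" where
  "monomial_coeff m r a = (if a = (\<lambda>i. if i \<in> {1..m} then r i else 0) then 1 else 0)"

lemma form_value_monomial_coeff:
  fixes y :: "nat \<Rightarrow> 'a::field_char_0"
  assumes "(\<Sum>i=1..m. r i) = N"
  shows "form_value {1..m} N (monomial_coeff m r) y = fact N * (\<Prod>i=1..m. y i ^ r i / fact (r i))"
proof -
  let ?r = "\<lambda>i. if i \<in> {1..m} then r i else 0"
  have mem: "?r \<in> multi_indices {1..m} N"
    using assms by (simp add: multi_indices_def)
  have "form_value {1..m} N (monomial_coeff m r) y =
      (\<Sum>d\<in>multi_indices {1..m} N. if d = ?r then fact N * (\<Prod>i=1..m. y i ^ d i / fact (d i)) else 0)"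
    unfolding form_value_def by (subst funpow_dird_multinomial) (auto simp: monomial_coeff_def intro!: sum.cong)
  also have "\<dots> = fact N * (\<Prod>i=1..m. y i ^ ?r i / fact (?r i))"
    using mem by (subst sum.delta) (simp_all only: finite_multi_indices finite_atLeastAtMost if_True)
  also have "\<dots> = fact N * (\<Prod>i=1..m. y i ^ r i / fact (r i))"
    by simp
  finally show ?thesis .
qed

text \<open>Evaluation at index 0 leaves exactly the tables with row sums \<open>r\<close>. The
  factor r_1! ... r_m! still missing from the permanent was divided out of the monomial.\<close>

lemma fold_dird_monomial_coeff:
  "fold (dird {1..m}) (column_list n c (\<lambda>j i. V i j)) (monomial_coeff m r) (\<lambda>_. 0) =
     (\<Prod>j=1..n. fact (c j)) * table_sum m n r c V"
proof -
  let ?W = "\<lambda>D. \<Prod>j=1..n. fact (c j) * (\<Prod>i=1..m. V i j ^ D i j / fact (D i j))"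
  have "contingency_tables m n r c =
      {D \<in> column_tables {1..m} n c. (\<lambda>i. \<Sum>j=1..n. D i j) = (\<lambda>i. if i \<in> {1..m} then r i else 0)}"
  proof (intro set_eqI iffI)
    fix D assume "D \<in> contingency_tables m n r c"
    then show "D \<in> {D \<in> column_tables {1..m} n c.
        (\<lambda>i. \<Sum>j=1..n. D i j) = (\<lambda>i. if i \<in> {1..m} then r i else 0)}"
      by (auto simp: contingency_tables_def column_tables_def fun_eq_iff)
  next
    fix D assume D: "D \<in> {D \<in> column_tables {1..m} n c.
        (\<lambda>i. \<Sum>j=1..n. D i j) = (\<lambda>i. if i \<in> {1..m} then r i else 0)}"
    then have "(\<Sum>j=1..n. D i j) = (if i \<in> {1..m} then r i else 0)" for i
      by (simp add: fun_eq_iff)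
    with D show "D \<in> contingency_tables m n r c"
      by (simp add: contingency_tables_def column_tables_def)
  qed
  moreover have "finite (column_tables {1..m} n c)"
    by (simp add: finite_column_tables)
  ultimately have "(\<Sum>D\<in>column_tables {1..m} n c.
      ?W D * monomial_coeff m r (\<lambda>i. 0 + (\<Sum>j=1..n. D i j))) = (\<Sum>D\<in>contingency_tables m n r c. ?W D)"
    by (intro sum.mono_neutral_cong_right) (auto simp: monomial_coeff_def)
  also have "\<dots> = (\<Prod>j=1..n. fact (c j)) * table_sum m n r c V"
    unfolding table_sum_def sum_distrib_left
    by (intro sum.cong refl, subst prod.swap) (simp add: prod.distrib)
  finally show ?thesis
    by (simp only: fold_dird_column_list finite_atLeastAtMost)
qed

text \<open>The capacity of the monomial comes from Jensen in each row: the row sums make the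
  entries (b_l)_i weights over l, so ln y_i is at least the mean of the ln \<alpha>_l. Weighting
  with r_i and using the column sums, the product of the y_i^r_i is at least that of the
  \<alpha>_l.\<close>

lemma table_sum_lower_bound:
  assumes "m \<ge> 1" and N: "(\<Sum>i=1..m. r i) = N" "(\<Sum>j=1..n. c j) = N"
    and V: "\<And>i j. i \<in> {1..m} \<Longrightarrow> j \<in> {1..n} \<Longrightarrow> V i j > 0"
    and row: "\<And>i. i \<in> {1..m} \<Longrightarrow> (\<Sum>j=1..n. real (c j) * V i j) = 1"
    and col: "\<And>j. j \<in> {1..n} \<Longrightarrow> (\<Sum>i=1..m. real (r i) * V i j) = 1"
  shows "fact N / real N ^ N \<le> (\<Prod>i=1..m. fact (r i)) * (\<Prod>j=1..n. fact (c j)) * table_sum m n r c V"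
proof -
  let ?g = "monomial_coeff m r :: (nat \<Rightarrow> nat) \<Rightarrow> real"
  define bs where "bs = column_list n c (\<lambda>j i. V i j)"
  \<comment> \<open>N! comes from evaluation in degree N, the denominator from the normalisation of
    the monomial.\<close>
  define L :: real where "L = fact N / (\<Prod>i=1..m. fact (r i))"
  have len: "length bs = N"
    using N(2) by (simp add: bs_def length_column_list)
  have setD: "\<exists>j\<in>{1..n}. b = (\<lambda>i. V i j)" if "b \<in> set bs" for b
    using that set_column_list[of n c "\<lambda>j i. V i j"] by (auto simp: bs_def)
  have bs_pos: "b i > 0" if "b \<in> set bs" "i \<in> {1..m}" for b i
    using setD[OF that(1)] V that(2) by auto
  have bs_col: "(\<Sum>i=1..m. real (r i) * b i) = 1" if "b \<in> set bs" for b
    using setD[OF that] col by auto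
  have bs_row: "(\<Sum>l<N. (bs ! l) i) = 1" if "i \<in> {1..m}" for i
  proof -
    have "(\<Sum>l<N. (bs ! l) i) = (\<Sum>b\<leftarrow>bs. b i)"
      using len by (simp add: sum_list_sum_nth atLeast0LessThan)
    then show ?thesis
      using row[OF that] by (simp add: bs_def sum_list_column_list)
  qed
  have Lpos: "(\<Prod>i=1..m. fact (r i) :: real) > 0"
    by (intro prod_pos) auto
  have "fold (dird {1..m}) bs ?g (\<lambda>_. 0) \<ge> L / real (length bs) ^ length bs"
  proof (rule form_value_capacity_bound)
    have "(\<lambda>a. complex_of_real (?g a)) = monomial_coeff m r"
      by (auto simp: monomial_coeff_def)
    \<comment> \<open>A monomial vanishes only where a variable does, hence nowhere in the open
      right half plane.\<close>
    then show "stable_form {1..m} (length bs) (\<lambda>a. complex_of_real (?g a))"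
      unfolding stable_form_def len by (simp only: form_value_monomial_coeff[OF N(1)]) auto
  next
    fix \<alpha> :: "nat \<Rightarrow> real" assume \<alpha>: "\<And>l. \<alpha> l > 0"
    let ?y = "\<lambda>i. \<Sum>l<N. \<alpha> l * (bs ! l) i"
    have N0: "N > 0"
    proof (rule ccontr)
      assume "\<not> N > 0"
      then show False using bs_row[of 1] \<open>m \<ge> 1\<close> by simp
    qed
    have ypos: "?y i > 0" if "i \<in> {1..m}" for i
      using \<alpha> bs_pos that len N0 by (intro sum_pos) (auto intro!: mult_pos_pos)
    have "(\<Sum>l<N. ln (\<alpha> l)) = (\<Sum>l<N. (\<Sum>i=1..m. real (r i) * (bs ! l) i) * ln (\<alpha> l))"
      using bs_col len by (intro sum.cong) auto
    also have "\<dots> = (\<Sum>i=1..m. real (r i) * (\<Sum>l<N. (bs ! l) i * ln (\<alpha> l)))"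
      unfolding sum_distrib_left sum_distrib_right by (subst sum.swap) (simp add: mult_ac)
    also have "\<dots> \<le> (\<Sum>i=1..m. real (r i) * ln (?y i))"
    proof (intro sum_mono mult_left_mono)
      fix i assume i: "i \<in> {1..m}"
      have "(\<Sum>l<N. (bs ! l) i * ln (\<alpha> l)) \<le> ln (\<Sum>l<N. (bs ! l) i * \<alpha> l)"
        using \<alpha> bs_pos i len bs_row by (intro weighted_ln_le_ln_weighted) (auto simp: less_imp_le)
      then show "(\<Sum>l<N. (bs ! l) i * ln (\<alpha> l)) \<le> ln (?y i)"
        by (simp add: mult.commute)
    qed auto
    finally have "ln (\<Prod>l<N. \<alpha> l) \<le> ln (\<Prod>i=1..m. ?y i ^ r i)"
      using \<alpha> ypos by (subst (1 2) ln_prod) (auto simp: ln_realpow less_imp_neq[symmetric])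
    then have "(\<Prod>l<N. \<alpha> l) \<le> (\<Prod>i=1..m. ?y i ^ r i)"
      using \<alpha> ypos by (subst (asm) ln_le_cancel_iff) (auto intro!: prod_pos)
    then have "L * (\<Prod>l<N. \<alpha> l) \<le> L * (\<Prod>i=1..m. ?y i ^ r i)"
      unfolding L_def using Lpos by (intro mult_left_mono) auto
    then show "L * (\<Prod>l<length bs. \<alpha> l) \<le>
        form_value {1..m} (length bs) ?g (\<lambda>i. \<Sum>l<length bs. \<alpha> l * (bs ! l) i)"
      unfolding len form_value_monomial_coeff[OF N(1)] L_def by (simp add: prod_dividef)
  qed (use bs_pos \<open>m \<ge> 1\<close> in \<open>auto simp: monomial_coeff_def\<close>)
  then have "L / real N ^ N \<le> (\<Prod>j=1..n. fact (c j)) * table_sum m n r c V"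
    unfolding len unfolding bs_def fold_dird_monomial_coeff .
  then have "(\<Prod>i=1..m. fact (r i)) * (L / real N ^ N) \<le>
      (\<Prod>i=1..m. fact (r i)) * ((\<Prod>j=1..n. fact (c j)) * table_sum m n r c V)"
    using Lpos by (intro mult_left_mono) auto
  moreover have "(\<Prod>i=1..m. fact (r i)) * (L / real N ^ N) = fact N / real N ^ N"
    using Lpos by (simp add: L_def)
  ultimately show ?thesis
    by (simp only: mult.assoc)
qed

text \<open>With \<open>\<rho>\<^sub>i b\<^sub>i\<close> a probability vector, \<open>dird I b\<close> averages the rescaled coefficients
  \<open>g a / \<rho>\<^sup>a\<close>, so it does not increase their maximum.\<close>

lemma dird_weighted_le:
  fixes g :: "(nat \<Rightarrow> nat) \<Rightarrow> real"
  assumes "finite I" "\<And>i. i \<in> I \<Longrightarrow> b i \<ge> 0" "(\<Sum>i\<in>I. \<rho> i * b i) = 1"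
    and g: "\<And>a. g a \<le> K * (\<Prod>i\<in>I. \<rho> i ^ a i)"
  shows "dird I b g a \<le> K * (\<Prod>i\<in>I. \<rho> i ^ a i)"
proof -
  have "dird I b g a \<le> (\<Sum>i\<in>I. b i * (K * (\<rho> i * (\<Prod>j\<in>I. \<rho> j ^ a j))))"
    unfolding dird_def
  proof (intro sum_mono mult_left_mono)
    fix i assume "i \<in> I"
    have "(\<Prod>j\<in>I. \<rho> j ^ (a(i := Suc (a i))) j) = \<rho> i * (\<Prod>j\<in>I. \<rho> j ^ a j)"
      using assms(1) \<open>i \<in> I\<close> by (simp add: prod.remove[of I i] cong: prod.cong_simp)
    then show "g (a(i := Suc (a i))) \<le> K * (\<rho> i * (\<Prod>j\<in>I. \<rho> j ^ a j))"
      using g[of "a(i := Suc (a i))"] by simp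
  qed (use assms in auto)
  also have "\<dots> = K * (\<Prod>i\<in>I. \<rho> i ^ a i) * (\<Sum>i\<in>I. \<rho> i * b i)"
    by (simp add: sum_distrib_left sum_distrib_right mult_ac)
  finally show ?thesis
    by (simp add: assms(3))
qed

lemma fold_dird_weighted_le:
  fixes g :: "(nat \<Rightarrow> nat) \<Rightarrow> real"
  assumes "finite I" "\<And>b i. b \<in> set bs \<Longrightarrow> i \<in> I \<Longrightarrow> b i \<ge> 0"
    "\<And>b. b \<in> set bs \<Longrightarrow> (\<Sum>i\<in>I. \<rho> i * b i) = 1"
    and "\<And>a. g a \<le> K * (\<Prod>i\<in>I. \<rho> i ^ a i)"
  shows "fold (dird I) bs g a \<le> K * (\<Prod>i\<in>I. \<rho> i ^ a i)"
  using assms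
proof (induction bs arbitrary: g)
  case (Cons b bs)
  have "dird I b g a \<le> K * (\<Prod>i\<in>I. \<rho> i ^ a i)" for a
    using Cons.prems by (intro dird_weighted_le) auto
  then show ?case
    using Cons by simp
qed simp

text \<open>With \<open>\<rho> = r\<close> the column sums turn every derivative into an average.
  The starting constant makes the bound an equality at the index \<open>r\<close>, where the
  monomial has coefficient 1; at index 0 the weights are all 1.\<close>

lemma table_sum_upper_bound:
  assumes r: "\<And>i. i \<in> {1..m} \<Longrightarrow> r i > 0"
    and V: "\<And>i j. i \<in> {1..m} \<Longrightarrow> j \<in> {1..n} \<Longrightarrow> V i j > 0"
    and col: "\<And>j. j \<in> {1..n} \<Longrightarrow> (\<Sum>i=1..m. real (r i) * V i j) = 1"
  shows "(\<Prod>i=1..m. fact (r i)) * (\<Prod>j=1..n. fact (c j)) * table_sum m n r c V \<le>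
    (\<Prod>i=1..m. fact (r i) / real (r i) ^ r i)"
proof -
  let ?R = "\<Prod>i=1..m. real (r i) ^ r i"
  have R: "?R > 0"
    using r by (intro prod_pos) auto
  have "(\<Prod>j=1..n. fact (c j)) * table_sum m n r c V \<le> 1 / ?R * (\<Prod>i=1..m. real (r i) ^ 0)"
    unfolding fold_dird_monomial_coeff[symmetric]
  proof (rule fold_dird_weighted_le)
    fix a
    have "0 \<le> (\<Prod>i=1..m. real (r i) ^ a i)"
      by (intro prod_nonneg) auto
    then show "monomial_coeff m r a \<le> 1 / ?R * (\<Prod>i=1..m. real (r i) ^ a i)"
      using R by (auto simp: monomial_coeff_def)
  next
    fix b assume "b \<in> set (column_list n c (\<lambda>j i. V i j))"
    then obtain j where "j \<in> {1..n}" "b = (\<lambda>i. V i j)"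
      using set_column_list[of n c "\<lambda>j i. V i j"] by blast
    then show "(\<Sum>i=1..m. real (r i) * b i) = 1" "\<And>i. i \<in> {1..m} \<Longrightarrow> b i \<ge> 0"
      using col V by (auto simp: less_imp_le)
  qed simp
  then have "(\<Prod>i=1..m. fact (r i)) * ((\<Prod>j=1..n. fact (c j)) * table_sum m n r c V) \<le>
      (\<Prod>i=1..m. fact (r i)) * (1 / ?R)"
    by (intro mult_left_mono prod_nonneg) auto
  then show ?thesis
    by (simp add: prod_dividef mult.assoc)
qed

lemma table_sum_transpose: "table_sum n m c r (\<lambda>j i. V i j) = table_sum m n r c V"
  unfolding table_sum_def
proof (rule sum.reindex_bij_witness[where i = "\<lambda>D i j. D j i" and j = "\<lambda>D i j. D j i"])
  fix D
  show "(\<Prod>i=1..m. \<Prod>j=1..n. V i j ^ D j i / fact (D j i)) =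
      (\<Prod>i=1..n. \<Prod>j=1..m. V j i ^ D i j / fact (D i j))"
    by (rule prod.swap)
qed (auto simp: contingency_tables_def)

section \<open>Existence and uniqueness of the scaling\<close>

definition block_index :: "nat \<Rightarrow> (nat \<Rightarrow> nat set) \<Rightarrow> nat \<Rightarrow> nat" where
  "block_index m R k = (THE i. i \<in> {1..m} \<and> k \<in> R i)"

lemma block_matrix_block_index: "block_matrix m n R C V k l = V (block_index m R k) (block_index n C l)"
  by (simp add: block_matrix_def block_index_def)

lemma block_index_eq:
  assumes "partition_with_sizes N m r R" "i \<in> {1..m}" "k \<in> R i"
  shows "block_index m R k = i"
  using assms unfolding block_index_def partition_with_sizes_def disjoint_family_on_def
  by (intro the_equality) blast+

lemma block_index_in:
  assumes "partition_with_sizes N m r R" "k \<in> {1..N}"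
  shows "block_index m R k \<in> {1..m}"
proof -
  obtain i where "i \<in> {1..m}" "k \<in> R i"
    using assms unfolding partition_with_sizes_def by blast
  then show ?thesis
    using block_index_eq[OF assms(1)] by simp
qed

lemma block_index_onto:
  assumes "partition_with_sizes N m r R" "i \<in> {1..m}" "r i > 0"
  shows "\<exists>k\<in>{1..N}. block_index m R k = i"
proof -
  have "R i \<noteq> {}"
    using assms unfolding partition_with_sizes_def by fastforce
  then obtain k where "k \<in> R i" by blast
  moreover have "k \<in> {1..N}"
    using assms(1,2) \<open>k \<in> R i\<close> unfolding partition_with_sizes_def by blast
  ultimately show ?thesis
    using block_index_eq[OF assms(1,2)] by blast
qed

lemma partition_with_sizes_finite:
  assumes "partition_with_sizes N m r R" "i \<in> {1..m}"
  shows "finite (R i)"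
  using assms unfolding partition_with_sizes_def by (metis UN_upper finite_atLeastAtMost finite_subset)

lemma sum_block_index:
  fixes f :: "nat \<Rightarrow> real"
  assumes "partition_with_sizes N m r R"
  shows "(\<Sum>k=1..N. f (block_index m R k)) = (\<Sum>i=1..m. real (r i) * f i)"
proof -
  have U: "{1..N} = (\<Union>i\<in>{1..m}. R i)"
    using assms by (simp add: partition_with_sizes_def)
  have "(\<Sum>k=1..N. f (block_index m R k)) = (\<Sum>i=1..m. \<Sum>k\<in>R i. f (block_index m R k))"
    unfolding U using assms partition_with_sizes_finite[OF assms]
    by (intro sum.UNION_disjoint) (auto simp: partition_with_sizes_def disjoint_family_on_def)
  also have "\<dots> = (\<Sum>i=1..m. \<Sum>k\<in>R i. f i)"
    using block_index_eq[OF assms] by (intro sum.cong refl) simp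
  also have "\<dots> = (\<Sum>i=1..m. real (r i) * f i)"
    using assms by (intro sum.cong) (auto simp: partition_with_sizes_def)
  finally show ?thesis .
qed

lemma prod_block_index:
  fixes f :: "nat \<Rightarrow> real"
  assumes "partition_with_sizes N m r R"
  shows "(\<Prod>k=1..N. f (block_index m R k)) = (\<Prod>i=1..m. f i ^ r i)"
proof -
  have U: "{1..N} = (\<Union>i\<in>{1..m}. R i)"
    using assms by (simp add: partition_with_sizes_def)
  have "(\<Prod>k=1..N. f (block_index m R k)) = (\<Prod>i=1..m. \<Prod>k\<in>R i. f (block_index m R k))"
    unfolding U using assms partition_with_sizes_finite[OF assms]
    by (intro prod.UNION_disjoint) (auto simp: partition_with_sizes_def disjoint_family_on_def)
  also have "\<dots> = (\<Prod>i=1..m. \<Prod>k\<in>R i. f i)"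
    using block_index_eq[OF assms] by (intro prod.cong refl) simp
  also have "\<dots> = (\<Prod>i=1..m. f i ^ r i)"
    using assms by (intro prod.cong) (auto simp: partition_with_sizes_def)
  finally show ?thesis .
qed

text \<open>A doubly stochastic B does not decrease the product of a positive vector w: apply Jensen
  in the rows of B w, then the column sums. Taking w = \<eta> z makes the product of the scaling a
  lower bound for a quotient that depends on \<open>A\<close> and \<open>z\<close> only.\<close>

lemma is_scaling_prod_le:
  assumes "is_scaling N A B \<xi> \<eta>" and z: "\<And>l. l \<in> {1..N} \<Longrightarrow> z l > 0"
  shows "(\<Prod>i=1..N. \<xi> i * \<eta> i) * (\<Prod>l=1..N. z l) \<le> (\<Prod>k=1..N. \<Sum>l=1..N. A k l * z l)"
proof -
  from assms(1) have B: "\<And>i j. i \<in> {1..N} \<Longrightarrow> j \<in> {1..N} \<Longrightarrow> B i j \<ge> 0"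
      "\<And>i. i \<in> {1..N} \<Longrightarrow> (\<Sum>j=1..N. B i j) = 1" "\<And>j. j \<in> {1..N} \<Longrightarrow> (\<Sum>i=1..N. B i j) = 1"
    and pos: "\<And>i. i \<in> {1..N} \<Longrightarrow> \<xi> i > 0" "\<And>j. j \<in> {1..N} \<Longrightarrow> \<eta> j > 0"
    and A: "\<And>i j. i \<in> {1..N} \<Longrightarrow> j \<in> {1..N} \<Longrightarrow> A i j = B i j * \<xi> i * \<eta> j"
    unfolding is_scaling_def doubly_stochastic_def by auto
  define w where "w l = \<eta> l * z l" for l
  have w: "w l > 0" if "l \<in> {1..N}" for l
    using that pos z by (simp add: w_def)
  have Bw: "(\<Sum>l=1..N. B k l * w l) > 0" if k: "k \<in> {1..N}" for k
  proof -
    obtain l where "l \<in> {1..N}" "B k l > 0"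
      using B(1)[OF k] B(2)[OF k] by (metis less_eq_real_def sum.neutral zero_neq_one)
    then show ?thesis
      using w B(1)[OF k] by (intro sum_pos2[of _ l]) (auto simp: less_imp_le)
  qed
  have "(\<Sum>l=1..N. ln (w l)) = (\<Sum>l=1..N. (\<Sum>k=1..N. B k l) * ln (w l))"
    using B(3) by (intro sum.cong) auto
  also have "\<dots> = (\<Sum>k=1..N. \<Sum>l=1..N. B k l * ln (w l))"
    unfolding sum_distrib_right by (rule sum.swap)
  also have "\<dots> \<le> (\<Sum>k=1..N. ln (\<Sum>l=1..N. B k l * w l))"
    using B w by (intro sum_mono weighted_ln_le_ln_weighted) auto
  finally have "ln (\<Prod>l=1..N. w l) \<le> ln (\<Prod>k=1..N. \<Sum>l=1..N. B k l * w l)"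
    using w Bw by (subst (1 2) ln_prod) (auto simp: less_imp_neq[symmetric])
  then have "(\<Prod>l=1..N. w l) \<le> (\<Prod>k=1..N. \<Sum>l=1..N. B k l * w l)"
    using w Bw by (subst (asm) ln_le_cancel_iff) (auto intro!: prod_pos)
  then have "(\<Prod>k=1..N. \<xi> k) * (\<Prod>l=1..N. w l) \<le> (\<Prod>k=1..N. \<xi> k) * (\<Prod>k=1..N. \<Sum>l=1..N. B k l * w l)"
    using pos by (intro mult_left_mono prod_nonneg) (auto simp: less_imp_le)
  also have "\<dots> = (\<Prod>k=1..N. \<Sum>l=1..N. A k l * z l)"
    unfolding prod.distrib[symmetric] sum_distrib_left
    by (intro prod.cong sum.cong refl) (simp add: A w_def)
  finally show ?thesis
    by (simp add: w_def prod.distrib mult.assoc)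
qed

text \<open>At z = 1 / \<eta>' the second scaling attains the bound, because the rows of
  \<open>A\<close> then sum to \<xi>'. Exchanging the roles gives equality of the products without
  comparing the scalings themselves.\<close>

lemma is_scaling_prod_unique:
  assumes "is_scaling N A B \<xi> \<eta>" "is_scaling N A B' \<xi>' \<eta>'"
  shows "(\<Prod>i=1..N. \<xi> i * \<eta> i) = (\<Prod>i=1..N. \<xi>' i * \<eta>' i)"
proof -
  have le: "(\<Prod>i=1..N. \<xi> i * \<eta> i) \<le> (\<Prod>i=1..N. \<xi>' i * \<eta>' i)"
    if 1: "is_scaling N A B \<xi> \<eta>" and 2: "is_scaling N A B' \<xi>' \<eta>'" for B \<xi> \<eta> B' \<xi>' \<eta>'
  proof -
    from 2 have eta: "\<And>l. l \<in> {1..N} \<Longrightarrow> \<eta>' l > 0"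
      by (simp add: is_scaling_def)
    have "(\<Sum>l=1..N. A k l * (1 / \<eta>' l)) = \<xi>' k" if k: "k \<in> {1..N}" for k
    proof -
      have "(\<Sum>l=1..N. A k l * (1 / \<eta>' l)) = (\<Sum>l=1..N. \<xi>' k * B' k l)"
        using 2 k eta by (intro sum.cong refl) (simp add: is_scaling_def less_imp_neq[symmetric])
      also have "\<dots> = \<xi>' k"
        using 2 k by (simp add: is_scaling_def doubly_stochastic_def flip: sum_distrib_left)
      finally show ?thesis .
    qed
    then have "(\<Prod>i=1..N. \<xi> i * \<eta> i) * (\<Prod>l=1..N. 1 / \<eta>' l) \<le> (\<Prod>k=1..N. \<xi>' k)"
      using is_scaling_prod_le[OF 1, of "\<lambda>l. 1 / \<eta>' l"] eta by simp
    moreover have "(\<Prod>l=1..N. \<eta>' l) > 0"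
      using eta by (intro prod_pos) auto
    ultimately show ?thesis
      by (simp add: prod_dividef prod.distrib divide_le_eq)
  qed
  show ?thesis
    using le[OF assms] le[OF assms(2,1)] by simp
qed

lemma scaling_factor_eq:
  assumes "positive_matrix N A" "is_scaling N A B \<xi> \<eta>"
  shows "scaling_factor N A = (\<Prod>i=1..N. \<xi> i * \<eta> i)"
proof -
  have "(THE s. \<exists>B \<xi> \<eta>. is_scaling N A B \<xi> \<eta> \<and> s = (\<Prod>i=1..N. \<xi> i * \<eta> i)) = (\<Prod>i=1..N. \<xi> i * \<eta> i)"
  proof (rule the_equality)
    show "\<exists>B' \<xi>' \<eta>'. is_scaling N A B' \<xi>' \<eta>' \<and> (\<Prod>i=1..N. \<xi> i * \<eta> i) = (\<Prod>i=1..N. \<xi>' i * \<eta>' i)"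
      using assms(2) by blast
    show "s = (\<Prod>i=1..N. \<xi> i * \<eta> i)"
      if "\<exists>B \<xi> \<eta>. is_scaling N A B \<xi> \<eta> \<and> s = (\<Prod>i=1..N. \<xi> i * \<eta> i)" for s
      using that is_scaling_prod_unique[OF assms(2)] by metis
  qed
  with assms(1) show ?thesis
    by (simp only: scaling_factor_def if_True)
qed

text \<open>The scaling of a block matrix is found at the minimum over positive \<open>x\<close> of the following
  homogeneous function, whose minimal value is the scaling factor.\<close>

definition scaling_objective ::
  "nat \<Rightarrow> nat \<Rightarrow> (nat \<Rightarrow> nat) \<Rightarrow> (nat \<Rightarrow> nat) \<Rightarrow> (nat \<Rightarrow> nat \<Rightarrow> real) \<Rightarrow> (nat \<Rightarrow> real) \<Rightarrow> real" where
  "scaling_objective m n r c V x =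
     (\<Prod>i=1..m. (\<Sum>j=1..n. real (c j) * V i j * x j) ^ r i) / (\<Prod>j=1..n. x j ^ c j)"

text \<open>Tychonoff's theorem. Vectors are total functions, so coordinates outside the range have
  to be pinned to a point for compactness.\<close>

lemma compact_cube:
  assumes "\<And>j. compact (K j :: real set)"
  shows "compact {x :: nat \<Rightarrow> real. \<forall>j. x j \<in> K j}"
proof -
  have "{x :: nat \<Rightarrow> real. \<forall>j. x j \<in> K j} = PiE UNIV K"
    by (auto simp: PiE_def Pi_def)
  moreover have "compactin (product_topology (\<lambda>_. euclidean) UNIV) (PiE UNIV K)"
    using assms by (auto simp: compactin_PiE)
  ultimately show ?thesis
    by (simp add: euclidean_product_topology)
qed

text \<open>The objective has degree 0, so the largest coordinate may be taken as 1. Every sum in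
  the numerator is then at least \<kappa>, while a coordinate below \<delta> pushes the denominator
  below \<delta>; there the objective is no smaller than at the all-ones point, and minimising over
  a compact cube suffices.\<close>

lemma scaling_objective_has_minimum:
  assumes "m \<ge> 1" "n \<ge> 1" and c: "\<And>j. j \<in> {1..n} \<Longrightarrow> c j > 0"
    and N: "(\<Sum>i=1..m. r i) = N" "(\<Sum>j=1..n. c j) = N"
    and V: "\<And>i j. i \<in> {1..m} \<Longrightarrow> j \<in> {1..n} \<Longrightarrow> V i j > 0"
  shows "\<exists>x. (\<forall>j\<in>{1..n}. x j > 0) \<and>
    (\<forall>y. (\<forall>j\<in>{1..n}. y j > 0) \<longrightarrow> scaling_objective m n r c V x \<le> scaling_objective m n r c V y)"
proof -
  let ?\<phi> = "scaling_objective m n r c V"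
  define \<kappa> where "\<kappa> = Min ((\<lambda>(i, j). real (c j) * V i j) ` ({1..m} \<times> {1..n}))"
  have ne: "{1..m} \<times> {1..n} \<noteq> {}"
    using assms(1,2) by auto
  have \<kappa>: "\<kappa> > 0"
    unfolding \<kappa>_def using ne c V by (subst Min_gr_iff) auto
  have \<kappa>_le: "\<kappa> \<le> real (c j) * V i j" if "i \<in> {1..m}" "j \<in> {1..n}" for i j
    unfolding \<kappa>_def using that by (intro Min_le) (auto intro!: rev_image_eqI[of "(i, j)"])
  have u_pos: "(\<Sum>j=1..n. real (c j) * V i j * x j) > 0"
    if "i \<in> {1..m}" "\<And>j. j \<in> {1..n} \<Longrightarrow> x j > 0" for i and x :: "nat \<Rightarrow> real"
    using that assms(2) c V by (intro sum_pos) auto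
  define M where "M = ?\<phi> (\<lambda>_. 1)"
  have M: "M > 0"
    unfolding M_def scaling_objective_def using u_pos[of _ "\<lambda>_. 1"] by (auto intro!: prod_pos)
  \<comment> \<open>Chosen for \<kappa>^N / \<delta> \<ge> M; the cap 1 keeps the all-ones point in
    the cube.\<close>
  define \<delta> where "\<delta> = min 1 (\<kappa> ^ N / M)"
  have \<delta>: "\<delta> > 0" "\<delta> \<le> 1" "\<delta> \<le> \<kappa> ^ N / M"
    using \<kappa> M by (auto simp: \<delta>_def)
  define S where "S = {x :: nat \<Rightarrow> real. \<forall>j. x j \<in> (if j \<in> {1..n} then {\<delta>..1} else {1})}"
  have "compact S"
    unfolding S_def by (rule compact_cube) auto
  moreover have 1: "(\<lambda>_. 1) \<in> S"
    using \<delta> by (auto simp: S_def)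
  moreover have S_pos: "x j > 0" if "x \<in> S" "j \<in> {1..n}" for x j
  proof -
    have "\<delta> \<le> x j"
      using that by (auto simp: S_def split: if_splits)
    then show ?thesis using \<delta> by simp
  qed
  have "continuous_on S ?\<phi>"
    unfolding scaling_objective_def
  proof (intro continuous_intros ballI)
    fix x assume "x \<in> S"
    then show "(\<Prod>j=1..n. x j ^ c j) \<noteq> 0"
      using S_pos by (auto simp: less_imp_neq[symmetric])
  qed (auto intro: continuous_on_product_coordinates continuous_on_subset[OF continuous_on_product_coordinates])
  ultimately obtain x where x: "x \<in> S" "\<And>y. y \<in> S \<Longrightarrow> ?\<phi> x \<le> ?\<phi> y"
    using continuous_attains_inf[of S ?\<phi>] by auto
  have "?\<phi> x \<le> ?\<phi> y" if y: "\<And>j. j \<in> {1..n} \<Longrightarrow> y j > 0" for y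
  proof -
    define \<mu> where "\<mu> = Max (y ` {1..n})"
    have "\<mu> \<in> y ` {1..n}"
      unfolding \<mu>_def using assms(2) by (intro Max_in) auto
    then obtain k where k: "k \<in> {1..n}" "\<mu> = y k" by auto
    have \<mu>: "\<mu> > 0" using k y by auto
    have le_\<mu>: "y j \<le> \<mu>" if "j \<in> {1..n}" for j
      unfolding \<mu>_def using that by (intro Max_ge) auto
    define z where "z j = (if j \<in> {1..n} then y j / \<mu> else 1)" for j
    have z: "z j > 0" "z j \<le> 1" for j
      using y \<mu> le_\<mu> by (auto simp: z_def)
    have "(\<Sum>j=1..n. real (c j) * V i j * z j) = (\<Sum>j=1..n. real (c j) * V i j * y j) / \<mu>" for i
      by (simp add: z_def sum_divide_distrib)
    then have "?\<phi> z = ?\<phi> y"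
      using \<mu> N by (simp add: scaling_objective_def z_def power_divide prod_dividef flip: power_sum)
    moreover have "?\<phi> x \<le> ?\<phi> z"
    proof (cases "z \<in> S")
      case False
      then obtain l where l: "l \<in> {1..n}" "z l < \<delta>"
        using z by (auto simp: S_def z_def not_le split: if_splits)
      have "M \<le> \<kappa> ^ N / \<delta>"
        using \<delta> M by (simp add: field_simps)
      also have "\<dots> \<le> \<kappa> ^ N / z l"
        using l z(1)[of l] \<kappa> \<delta> by (intro divide_left_mono mult_pos_pos) auto
      also have "\<dots> \<le> ?\<phi> z"
        unfolding scaling_objective_def
      proof (rule frac_le)
        have "\<kappa> ^ N = (\<Prod>i=1..m. \<kappa> ^ r i)"
          unfolding power_sum[symmetric] N(1) ..
        also have "\<dots> \<le> (\<Prod>i=1..m. (\<Sum>j=1..n. real (c j) * V i j * z j) ^ r i)"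
        proof (intro prod_mono conjI power_mono)
          fix i assume i: "i \<in> {1..m}"
          have "\<kappa> \<le> real (c k) * V i k * z k"
            using \<kappa>_le[OF i k(1)] k \<mu> by (simp add: z_def)
          also have "\<dots> \<le> (\<Sum>j=1..n. real (c j) * V i j * z j)"
            using k z V i by (intro member_le_sum) (auto simp: less_imp_le)
          finally show "\<kappa> \<le> (\<Sum>j=1..n. real (c j) * V i j * z j)" .
        qed (use \<kappa> in auto)
        finally show "\<kappa> ^ N \<le> (\<Prod>i=1..m. (\<Sum>j=1..n. real (c j) * V i j * z j) ^ r i)" .
        show "(\<Prod>j=1..n. z j ^ c j) \<le> z l"
        proof -
          have "(\<Prod>j=1..n. z j ^ c j) = z l ^ c l * (\<Prod>j\<in>{1..n} - {l}. z j ^ c j)"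
            using l by (intro prod.remove) auto
          also have "\<dots> \<le> z l ^ 1 * 1"
            using z c[OF l(1)] by (intro mult_mono power_decreasing prod_le_1)
              (auto simp: less_imp_le power_le_one intro!: prod_nonneg)
          finally show ?thesis by simp
        qed
      qed (use \<kappa> z in \<open>auto intro!: prod_pos prod_nonneg sum_nonneg mult_nonneg_nonneg zero_le_power simp: V less_imp_le\<close>)
      finally show ?thesis
        using x(2)[OF 1] by (simp add: M_def)
    qed (use x in auto)
    ultimately show ?thesis by simp
  qed
  then show ?thesis
    using S_pos[OF x(1)] by blast
qed

lemma scaling_objective_minimum_stationary:
  assumes "n \<ge> 1" and c: "\<And>j. j \<in> {1..n} \<Longrightarrow> c j > 0"
    and V: "\<And>i j. i \<in> {1..m} \<Longrightarrow> j \<in> {1..n} \<Longrightarrow> V i j > 0"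
    and x: "\<And>j. j \<in> {1..n} \<Longrightarrow> x j > 0"
    and min: "\<And>y. (\<And>j. j \<in> {1..n} \<Longrightarrow> y j > 0) \<Longrightarrow>
      scaling_objective m n r c V x \<le> scaling_objective m n r c V y"
    and j: "j \<in> {1..n}"
  shows "(\<Sum>i=1..m. real (r i) * V i j / (\<Sum>l=1..n. real (c l) * V i l * x l)) = 1 / x j"
proof -
  let ?u = "\<lambda>x i. \<Sum>l=1..n. real (c l) * V i l * x l"
  have u_pos: "?u y i > 0" if "i \<in> {1..m}" "\<And>j. j \<in> {1..n} \<Longrightarrow> y j > 0" for i and y :: "nat \<Rightarrow> real"
    using that assms(1) c V by (intro sum_pos) auto
  have ln_obj: "ln (scaling_objective m n r c V y) =
      (\<Sum>i=1..m. real (r i) * ln (?u y i)) - (\<Sum>l=1..n. real (c l) * ln (y l))"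
    and obj_pos: "scaling_objective m n r c V y > 0"
    if y: "\<And>j. j \<in> {1..n} \<Longrightarrow> y j > 0" for y
  proof -
    have pos: "(\<Prod>i=1..m. ?u y i ^ r i) > 0" "(\<Prod>l=1..n. y l ^ c l) > 0"
      using y u_pos[OF _ y] by (auto intro!: prod_pos)
    have "ln (\<Prod>i=1..m. ?u y i ^ r i) = (\<Sum>i=1..m. real (r i) * ln (?u y i))"
      using u_pos[OF _ y] by (subst ln_prod) (auto simp: ln_realpow less_imp_neq[symmetric])
    moreover have "ln (\<Prod>l=1..n. y l ^ c l) = (\<Sum>l=1..n. real (c l) * ln (y l))"
      using y by (subst ln_prod) (auto simp: ln_realpow less_imp_neq[symmetric])
    ultimately show "ln (scaling_objective m n r c V y) =
        (\<Sum>i=1..m. real (r i) * ln (?u y i)) - (\<Sum>l=1..n. real (c l) * ln (y l))"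
      "scaling_objective m n r c V y > 0"
      unfolding scaling_objective_def using pos
      by (simp_all only: ln_divide_pos divide_pos_pos)
  qed
  define w where "w i = ?u x i" for i
  have w: "w i > 0" if "i \<in> {1..m}" for i
    unfolding w_def using that x by (rule u_pos)
  \<comment> \<open>The logarithm of the objective along the j-th coordinate, up to terms
    independent of t.\<close>
  define h where "h t = (\<Sum>i=1..m. real (r i) * ln (?u x i + real (c j) * V i j * t)) - real (c j) * ln (x j + t)" for t
  have "(\<Sum>i=1..m. real (r i) * (real (c j) * V i j / ?u x i)) - real (c j) * (1 / x j) = 0"
  proof (rule DERIV_local_min)
    show "DERIV h 0 :> (\<Sum>i=1..m. real (r i) * (real (c j) * V i j / ?u x i)) - real (c j) * (1 / x j)"
      unfolding h_def w_def[symmetric] using x[OF j] w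
      by (auto intro!: derivative_eq_intros sum.cong simp: mult_ac)
    show "0 < x j" using x j .
    show "\<forall>t. \<bar>0 - t\<bar> < x j \<longrightarrow> h 0 \<le> h t"
    proof (intro allI impI)
      fix t assume t: "\<bar>0 - t\<bar> < x j"
      define y where "y = x(j := x j + t)"
      have y: "y l > 0" if "l \<in> {1..n}" for l
        using x[OF that] t by (auto simp: y_def)
      have uy: "?u y i = ?u x i + real (c j) * V i j * t" for i
      proof -
        have "?u y i = (\<Sum>l=1..n. real (c l) * V i l * x l + (if l = j then real (c j) * V i j * t else 0))"
          by (intro sum.cong) (auto simp: y_def algebra_simps)
        then show ?thesis
          using j by (simp add: sum.distrib)
      qed
      have ly: "(\<Sum>l=1..n. real (c l) * ln (y l)) =
          (\<Sum>l=1..n. real (c l) * ln (x l)) - real (c j) * ln (x j) + real (c j) * ln (x j + t)"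
      proof -
        have "(\<Sum>l=1..n. real (c l) * ln (y l)) = (\<Sum>l=1..n. real (c l) * ln (x l) +
            (if l = j then real (c j) * ln (x j + t) - real (c j) * ln (x j) else 0))"
          by (intro sum.cong) (auto simp: y_def)
        then show ?thesis
          using j by (simp add: sum.distrib)
      qed
      have "ln (scaling_objective m n r c V x) \<le> ln (scaling_objective m n r c V y)"
        using min[of y] obj_pos[of x] obj_pos[of y] x y by simp
      then show "h 0 \<le> h t"
        using ln_obj[of x] ln_obj[of y] x y by (simp only: uy ly) (simp add: h_def)
    qed
  qed
  then have "real (c j) * (\<Sum>i=1..m. real (r i) * V i j / ?u x i) = real (c j) * (1 / x j)"
    by (simp add: sum_distrib_left mult_ac)
  then show ?thesis
    using c[OF j] unfolding mult_cancel_left by simp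
qed

text \<open>With the numerator sums at the minimiser as \<open>u\<close>, the rows of
  \<open>U\<close> sum to 1 by construction and the columns by stationarity. The last two clauses,
  an attained minimum, prepare measurability.\<close>

lemma block_scaling_exists:
  assumes "m \<ge> 1" "n \<ge> 1" and r: "\<And>i. i \<in> {1..m} \<Longrightarrow> r i > 0" and c: "\<And>j. j \<in> {1..n} \<Longrightarrow> c j > 0"
    and N: "(\<Sum>i=1..m. r i) = N" "(\<Sum>j=1..n. c j) = N"
    and V: "\<And>i j. i \<in> {1..m} \<Longrightarrow> j \<in> {1..n} \<Longrightarrow> V i j > 0"
    and part: "partition_with_sizes N m r R" "partition_with_sizes N n c C"
  shows "\<exists>x u U. (\<forall>j\<in>{1..n}. x j > 0) \<and> (\<forall>i\<in>{1..m}. u i > 0) \<and>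
    (\<forall>i\<in>{1..m}. \<forall>j\<in>{1..n}. U i j > 0 \<and> V i j = U i j * u i / x j) \<and>
    (\<forall>i\<in>{1..m}. (\<Sum>j=1..n. real (c j) * U i j) = 1) \<and>
    (\<forall>j\<in>{1..n}. (\<Sum>i=1..m. real (r i) * U i j) = 1) \<and>
    scaling_factor N (block_matrix m n R C V) = (\<Prod>i=1..m. u i ^ r i) / (\<Prod>j=1..n. x j ^ c j) \<and>
    scaling_factor N (block_matrix m n R C V) = scaling_objective m n r c V x \<and>
    (\<forall>y. (\<forall>j\<in>{1..n}. y j > 0) \<longrightarrow>
       scaling_factor N (block_matrix m n R C V) \<le> scaling_objective m n r c V y)"
proof -
  obtain x where x: "\<And>j. j \<in> {1..n} \<Longrightarrow> x j > 0"
      and min: "\<And>y. (\<And>j. j \<in> {1..n} \<Longrightarrow> y j > 0) \<Longrightarrow>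
        scaling_objective m n r c V x \<le> scaling_objective m n r c V y"
    using scaling_objective_has_minimum[where V = V and c = c and r = r, OF assms(1,2) c N V] by blast
  define u where "u i = (\<Sum>j=1..n. real (c j) * V i j * x j)" for i
  define U where "U i j = V i j * x j / u i" for i j
  have u: "u i > 0" if "i \<in> {1..m}" for i
    unfolding u_def using that assms(2) c V x by (intro sum_pos) auto
  have U: "U i j > 0" "V i j = U i j * u i / x j" if "i \<in> {1..m}" "j \<in> {1..n}" for i j
    using V[OF that] u[OF that(1)] x[OF that(2)] by (simp_all add: U_def)
  have row: "(\<Sum>j=1..n. real (c j) * U i j) = 1" if "i \<in> {1..m}" for i
  proof -
    have "(\<Sum>j=1..n. real (c j) * U i j) = u i / u i"
      unfolding U_def u_def[of i] sum_divide_distrib times_divide_eq_right mult.assoc ..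
    then show ?thesis using u[OF that] by simp
  qed
  have col: "(\<Sum>i=1..m. real (r i) * U i j) = 1" if j: "j \<in> {1..n}" for j
  proof -
    have "(\<Sum>i=1..m. real (r i) * U i j) = (\<Sum>i=1..m. real (r i) * V i j / u i) * x j"
      unfolding U_def sum_distrib_right by (simp add: mult_ac)
    also have "\<dots> = 1"
      using scaling_objective_minimum_stationary[OF assms(2) c V x min j] x[OF j] unfolding u_def[symmetric] by simp
    finally show ?thesis .
  qed
  let ?A = "block_matrix m n R C V"
  let ?\<xi> = "\<lambda>k. u (block_index m R k)" and ?\<eta> = "\<lambda>l. 1 / x (block_index n C l)"
  note in_m = block_index_in[OF part(1)] and in_n = block_index_in[OF part(2)]
  have "positive_matrix N ?A"
    using V in_m in_n unfolding positive_matrix_def block_matrix_block_index by blast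
  moreover have "is_scaling N ?A (block_matrix m n R C U) ?\<xi> ?\<eta>"
    unfolding is_scaling_def doubly_stochastic_def block_matrix_block_index
  proof (intro conjI ballI)
    fix k l assume kl: "k \<in> {1..N}" "l \<in> {1..N}"
    show "U (block_index m R k) (block_index n C l) \<ge> 0"
      using U(1)[OF in_m[OF kl(1)] in_n[OF kl(2)]] by simp
    show "V (block_index m R k) (block_index n C l) =
        U (block_index m R k) (block_index n C l) * ?\<xi> k * ?\<eta> l"
      using U(2)[OF in_m[OF kl(1)] in_n[OF kl(2)]] by simp
  next
    fix k assume k: "k \<in> {1..N}"
    show "u (block_index m R k) > 0" "1 / x (block_index n C k) > 0"
      using u[OF in_m[OF k]] x[OF in_n[OF k]] by simp_all
    show "(\<Sum>l=1..N. U (block_index m R k) (block_index n C l)) = 1"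
      using sum_block_index[OF part(2), of "U (block_index m R k)"] row[OF in_m[OF k]] by simp
    show "(\<Sum>i=1..N. U (block_index m R i) (block_index n C k)) = 1"
      using sum_block_index[OF part(1), of "\<lambda>i. U i (block_index n C k)"] col[OF in_n[OF k]] by simp
  qed
  ultimately have "scaling_factor N ?A = (\<Prod>i=1..N. ?\<xi> i * ?\<eta> i)"
    by (rule scaling_factor_eq)
  also have "\<dots> = (\<Prod>i=1..m. u i ^ r i) * (\<Prod>j=1..n. (1 / x j) ^ c j)"
    unfolding prod.distrib prod_block_index[OF part(1)] prod_block_index[OF part(2), of "\<lambda>j. 1 / x j"] ..
  also have "\<dots> = (\<Prod>i=1..m. u i ^ r i) / (\<Prod>j=1..n. x j ^ c j)"
    by (simp add: power_one_over prod_dividef)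
  finally have eq: "scaling_factor N ?A = (\<Prod>i=1..m. u i ^ r i) / (\<Prod>j=1..n. x j ^ c j)" .
  then have eq': "scaling_factor N ?A = scaling_objective m n r c V x"
    unfolding scaling_objective_def u_def .
  show ?thesis
  proof (rule exI[of _ x], rule exI[of _ u], rule exI[of _ U], intro conjI ballI allI impI)
    show "scaling_factor N ?A \<le> scaling_objective m n r c V y" if "\<forall>j\<in>{1..n}. y j > 0" for y
      unfolding eq' using that by (intro min) blast
  qed (fact x u U row col eq eq')+
qed

section \<open>Bounds and measurability of the scaling factor\<close>

text \<open>All tables share the same margins, so \<open>u\<close> and \<open>v\<close> leave the
  sum with fixed exponents.\<close>

lemma table_sum_scale:
  assumes "\<And>i j. i \<in> {1..m} \<Longrightarrow> j \<in> {1..n} \<Longrightarrow> V i j = U i j * u i * v j"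
  shows "table_sum m n r c V = (\<Prod>i=1..m. u i ^ r i) * (\<Prod>j=1..n. v j ^ c j) * table_sum m n r c U"
  unfolding table_sum_def sum_distrib_left
proof (rule sum.cong[OF refl])
  fix D assume D: "D \<in> contingency_tables m n r c"
  have "(\<Prod>i=1..m. \<Prod>j=1..n. V i j ^ D i j / fact (D i j)) =
      (\<Prod>i=1..m. \<Prod>j=1..n. u i ^ D i j * (v j ^ D i j * (U i j ^ D i j / fact (D i j))))"
    by (intro prod.cong refl) (simp add: assms power_mult_distrib)
  also have "\<dots> = (\<Prod>i=1..m. \<Prod>j=1..n. u i ^ D i j) *
      ((\<Prod>i=1..m. \<Prod>j=1..n. v j ^ D i j) * (\<Prod>i=1..m. \<Prod>j=1..n. U i j ^ D i j / fact (D i j)))"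
    by (simp only: prod.distrib)
  also have "(\<Prod>i=1..m. \<Prod>j=1..n. u i ^ D i j) = (\<Prod>i=1..m. u i ^ r i)"
    using D by (intro prod.cong) (auto simp: contingency_tables_def simp flip: power_sum)
  also have "(\<Prod>i=1..m. \<Prod>j=1..n. v j ^ D i j) = (\<Prod>j=1..n. v j ^ c j)"
    using D by (subst prod.swap, intro prod.cong) (auto simp: contingency_tables_def simp flip: power_sum)
  finally show "(\<Prod>i=1..m. \<Prod>j=1..n. V i j ^ D i j / fact (D i j)) =
      (\<Prod>i=1..m. u i ^ r i) * (\<Prod>j=1..n. v j ^ c j) * (\<Prod>i=1..m. \<Prod>j=1..n. U i j ^ D i j / fact (D i j))"
    by (simp only: mult.assoc)
qed

text \<open>The quantity \<open>\<Prod>\<^sub>i r\<^sub>i! \<Prod>\<^sub>j c\<^sub>j! table_sum\<close> is the permanent of the block matrix; the bounds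
  are van der Waerden's lower bound and an upper bound of Bregman type.\<close>

lemma scaling_factor_table_sum_bounds:
  assumes "m \<ge> 1" "n \<ge> 1" and r: "\<And>i. i \<in> {1..m} \<Longrightarrow> r i > 0" and c: "\<And>j. j \<in> {1..n} \<Longrightarrow> c j > 0"
    and N: "(\<Sum>i=1..m. r i) = N" "(\<Sum>j=1..n. c j) = N"
    and V: "\<And>i j. i \<in> {1..m} \<Longrightarrow> j \<in> {1..n} \<Longrightarrow> V i j > 0"
    and part: "partition_with_sizes N m r R" "partition_with_sizes N n c C"
  defines "P \<equiv> (\<Prod>i=1..m. fact (r i)) * (\<Prod>j=1..n. fact (c j)) * table_sum m n r c V"
    and "\<sigma> \<equiv> scaling_factor N (block_matrix m n R C V)"
  shows "0 \<le> \<sigma>" and "fact N / real N ^ N * \<sigma> \<le> P"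
    and "P \<le> min (\<Prod>i=1..m. fact (r i) / real (r i) ^ r i) (\<Prod>j=1..n. fact (c j) / real (c j) ^ c j) * \<sigma>"
proof -
  obtain x u U where x: "\<And>j. j \<in> {1..n} \<Longrightarrow> x j > (0::real)" and u: "\<And>i. i \<in> {1..m} \<Longrightarrow> u i > (0::real)"
    and U: "\<And>i j. i \<in> {1..m} \<Longrightarrow> j \<in> {1..n} \<Longrightarrow> U i j > 0"
    and VU: "\<And>i j. i \<in> {1..m} \<Longrightarrow> j \<in> {1..n} \<Longrightarrow> V i j = U i j * u i / x j"
    and row: "\<And>i. i \<in> {1..m} \<Longrightarrow> (\<Sum>j=1..n. real (c j) * U i j) = 1"
    and col: "\<And>j. j \<in> {1..n} \<Longrightarrow> (\<Sum>i=1..m. real (r i) * U i j) = 1"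
    and \<sigma>: "\<sigma> = (\<Prod>i=1..m. u i ^ r i) / (\<Prod>j=1..n. x j ^ c j)"
    using block_scaling_exists[of m n r c N V R C, OF assms(1,2) r c N V part]
    unfolding \<sigma>_def by blast
  have "\<sigma> > 0"
    unfolding \<sigma> using x u by (auto intro!: divide_pos_pos prod_pos)
  then show "0 \<le> \<sigma>" by simp
  let ?F = "(\<Prod>i=1..m. fact (r i)) * (\<Prod>j=1..n. fact (c j)) :: real"
  let ?Q = "?F * table_sum m n r c U"
  have "table_sum m n r c V = \<sigma> * table_sum m n r c U"
    using table_sum_scale[of m n V U u "\<lambda>j. 1 / x j" r c] VU
    by (simp add: \<sigma> power_one_over prod_dividef)
  then have P: "P = ?Q * \<sigma>"
    unfolding P_def by simp
  have "fact N / real N ^ N \<le> ?Q"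
    by (rule table_sum_lower_bound) (use assms(1) N U row col in auto)
  then show "fact N / real N ^ N * \<sigma> \<le> P"
    unfolding P using \<open>\<sigma> > 0\<close> by (intro mult_right_mono) auto
  have "?Q \<le> (\<Prod>i=1..m. fact (r i) / real (r i) ^ r i)"
    by (rule table_sum_upper_bound) (use r U col in auto)
  moreover have "?Q \<le> (\<Prod>j=1..n. fact (c j) / real (c j) ^ c j)"
  proof -
    have "(\<Prod>j=1..n. fact (c j)) * (\<Prod>i=1..m. fact (r i)) * table_sum n m c r (\<lambda>j i. U i j) \<le>
        (\<Prod>j=1..n. fact (c j) / real (c j) ^ c j)"
      by (rule table_sum_upper_bound) (use c U row in auto)
    then show ?thesis
      by (simp only: table_sum_transpose[of n m c r U] mult.commute)
  qed
  ultimately show "P \<le> min (\<Prod>i=1..m. fact (r i) / real (r i) ^ r i) (\<Prod>j=1..n. fact (c j) / real (c j) ^ c j) * \<sigma>"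
    unfolding P using \<open>\<sigma> > 0\<close> by (intro mult_right_mono) auto
qed

text \<open>A strict inequality at the minimiser persists at nearby rational points by continuity;
  conversely each positive point bounds the scaling factor from above. The point is that the
  rational points form a countable set.\<close>

lemma scaling_factor_less_iff:
  assumes "m \<ge> 1" "n \<ge> 1" and r: "\<And>i. i \<in> {1..m} \<Longrightarrow> r i > 0" and c: "\<And>j. j \<in> {1..n} \<Longrightarrow> c j > 0"
    and N: "(\<Sum>i=1..m. r i) = N" "(\<Sum>j=1..n. c j) = N"
    and V: "\<And>i j. i \<in> {1..m} \<Longrightarrow> j \<in> {1..n} \<Longrightarrow> V i j > 0"
    and part: "partition_with_sizes N m r R" "partition_with_sizes N n c C"
  shows "scaling_factor N (block_matrix m n R C V) < a \<longleftrightarrow>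
    (\<exists>q \<in> PiE {1..n} (\<lambda>_. {0<..} \<inter> \<rat>). scaling_objective m n r c V q < a)"
proof -
  obtain x where x: "\<forall>j\<in>{1..n}. x j > 0"
    and eq: "scaling_factor N (block_matrix m n R C V) = scaling_objective m n r c V x"
    and le: "\<forall>y. (\<forall>j\<in>{1..n}. y j > 0) \<longrightarrow>
      scaling_factor N (block_matrix m n R C V) \<le> scaling_objective m n r c V y"
    using block_scaling_exists[of m n r c N V R C, OF assms(1,2) r c N V part]
    by blast
  show ?thesis
  proof
    assume less: "scaling_factor N (block_matrix m n R C V) < a"
    \<comment> \<open>Approximation from above keeps the coordinates in the range positive.\<close>
    have "\<exists>q. q \<in> \<rat> \<and> x j < q \<and> q < x j + inverse (real (Suc k))" for j k
      using Rats_dense_in_real[of "x j" "x j + inverse (real (Suc k))"] by auto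
    then obtain q where q: "\<And>j k. q j k \<in> \<rat>" "\<And>j k. x j < q j k" "\<And>j k. q j k < x j + inverse (real (Suc k))"
      by metis
    have lim: "(\<lambda>k. q j k) \<longlonglongrightarrow> x j" for j
    proof (rule tendsto_sandwich[OF _ _ tendsto_const])
      show "(\<lambda>k. x j + inverse (real (Suc k))) \<longlonglongrightarrow> x j"
        using tendsto_add[OF tendsto_const LIMSEQ_inverse_real_of_nat, of "x j"] by simp
    qed (use q in \<open>auto simp: less_imp_le\<close>)
    have "(\<lambda>k. scaling_objective m n r c V (\<lambda>j. q j k)) \<longlonglongrightarrow> scaling_objective m n r c V x"
      unfolding scaling_objective_def using x
      by (intro tendsto_intros lim) (auto simp: less_imp_neq[symmetric])
    then have "\<forall>\<^sub>F k in sequentially. scaling_objective m n r c V (\<lambda>j. q j k) < a"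
      using less unfolding eq by (rule order_tendstoD)
    then obtain k where k: "scaling_objective m n r c V (\<lambda>j. q j k) < a"
      using eventually_happens sequentially_bot by blast
    \<comment> \<open>The objective reads only coordinates in the range, so cutting off the rest to
      land in the countable \<open>PiE\<close> changes nothing.\<close>
    let ?q = "restrict (\<lambda>j. q j k) {1..n}"
    have "scaling_objective m n r c V ?q = scaling_objective m n r c V (\<lambda>j. q j k)"
      unfolding scaling_objective_def by simp
    moreover have "q j k > 0" if "j \<in> {1..n}" for j
      using bspec[OF x that] q(2)[of j k] by simp
    then have "?q \<in> PiE {1..n} (\<lambda>_. {0<..} \<inter> \<rat>)"
      using q(1) by auto
    ultimately show "\<exists>q \<in> PiE {1..n} (\<lambda>_. {0<..} \<inter> \<rat>). scaling_objective m n r c V q < a"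
      using k by metis
  next
    assume "\<exists>q \<in> PiE {1..n} (\<lambda>_. {0<..} \<inter> \<rat>). scaling_objective m n r c V q < a"
    then obtain q where q: "q \<in> PiE {1..n} (\<lambda>_. {0<..} \<inter> \<rat>)" "scaling_objective m n r c V q < a"
      by blast
    have "q j > 0" if "j \<in> {1..n}" for j
      using PiE_mem[OF q(1) that] by simp
    then show "scaling_factor N (block_matrix m n R C V) < a"
      using le[rule_format, of q] q(2) by (meson le_less_trans)
  qed
qed

text \<open>All blocks are nonempty, so each \<open>V i j\<close> does occur as an entry.\<close>

lemma positive_block_matrix_iff:
  assumes r: "\<And>i. i \<in> {1..m} \<Longrightarrow> r i > 0" and c: "\<And>j. j \<in> {1..n} \<Longrightarrow> c j > 0"
    and part: "partition_with_sizes N m r R" "partition_with_sizes N n c C"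
  shows "positive_matrix N (block_matrix m n R C V) \<longleftrightarrow> (\<forall>i\<in>{1..m}. \<forall>j\<in>{1..n}. V i j > 0)"
proof
  assume pos: "positive_matrix N (block_matrix m n R C V)"
  show "\<forall>i\<in>{1..m}. \<forall>j\<in>{1..n}. V i j > 0"
  proof (intro ballI)
    fix i j assume ij: "i \<in> {1..m}" "j \<in> {1..n}"
    obtain k l where "k \<in> {1..N}" "l \<in> {1..N}" "block_index m R k = i" "block_index n C l = j"
      using block_index_onto[OF part(1) ij(1) r[OF ij(1)]] block_index_onto[OF part(2) ij(2) c[OF ij(2)]] by blast
    then show "V i j > 0"
      using pos unfolding positive_matrix_def block_matrix_block_index by blast
  qed
next
  assume "\<forall>i\<in>{1..m}. \<forall>j\<in>{1..n}. V i j > 0"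
  then show "positive_matrix N (block_matrix m n R C V)"
    using block_index_in[OF part(1)] block_index_in[OF part(2)]
    unfolding positive_matrix_def block_matrix_block_index by blast
qed

lemma scaling_factor_measurable:
  fixes V :: "'a \<Rightarrow> nat \<Rightarrow> nat \<Rightarrow> real"
  assumes "m \<ge> 1" "n \<ge> 1" and r: "\<And>i. i \<in> {1..m} \<Longrightarrow> r i > 0" and c: "\<And>j. j \<in> {1..n} \<Longrightarrow> c j > 0"
    and N: "(\<Sum>i=1..m. r i) = N" "(\<Sum>j=1..n. c j) = N"
    and part: "partition_with_sizes N m r R" "partition_with_sizes N n c C"
    and V: "\<And>i j. i \<in> {1..m} \<Longrightarrow> j \<in> {1..n} \<Longrightarrow> (\<lambda>\<omega>. V \<omega> i j) \<in> borel_measurable M"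
  shows "(\<lambda>\<omega>. scaling_factor N (block_matrix m n R C (V \<omega>))) \<in> borel_measurable M"
  unfolding borel_measurable_iff_less
proof
  fix a
  let ?pos = "{\<omega> \<in> space M. \<forall>i\<in>{1..m}. \<forall>j\<in>{1..n}. V \<omega> i j > 0}"
  let ?Q = "PiE {1..n} (\<lambda>_. {0<..} \<inter> \<rat>) :: (nat \<Rightarrow> real) set"
  let ?less = "\<lambda>q. {\<omega> \<in> space M. scaling_objective m n r c (V \<omega>) q < a}"
  have pos: "?pos \<in> sets M"
    using V assms(1,2) by (intro sets.sets_Collect_finite_All' borel_measurable_less) auto
  have "(\<lambda>\<omega>. scaling_objective m n r c (V \<omega>) q) \<in> borel_measurable M" for q
    unfolding scaling_objective_def using V
    by (intro borel_measurable_divide borel_measurable_prod borel_measurable_power borel_measurable_sum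
        borel_measurable_times borel_measurable_const) auto
  then have less: "?less q \<in> sets M" for q
    unfolding borel_measurable_iff_less by blast
  have "countable ?Q"
    by (intro countable_PiE) (auto intro: countable_subset[OF _ countable_rat])
  then have U: "(\<Union>q\<in>?Q. ?less q) \<in> sets M"
    using less by (intro sets.countable_UN') auto
  have nonpos: "scaling_factor N (block_matrix m n R C (V \<omega>)) = 0"
    if "\<not> (\<forall>i\<in>{1..m}. \<forall>j\<in>{1..n}. V \<omega> i j > 0)" for \<omega>
    using that positive_block_matrix_iff[where r = r and c = c and V = "V \<omega>", OF r c part]
    by (simp only: scaling_factor_def if_False)
  \<comment> \<open>Off the positive set the scaling factor is the dummy 0, so that part of the
    event is everything or nothing according to whether 0 < a.\<close>
  have "{\<omega> \<in> space M. scaling_factor N (block_matrix m n R C (V \<omega>)) < a} =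
      (?pos \<inter> (\<Union>q\<in>?Q. ?less q)) \<union> (if 0 < a then space M - ?pos else {})"
  proof (intro set_eqI)
    fix \<omega>
    show "\<omega> \<in> {\<omega> \<in> space M. scaling_factor N (block_matrix m n R C (V \<omega>)) < a} \<longleftrightarrow>
      \<omega> \<in> (?pos \<inter> (\<Union>q\<in>?Q. ?less q)) \<union> (if 0 < a then space M - ?pos else {})"
    proof (cases "\<forall>i\<in>{1..m}. \<forall>j\<in>{1..n}. V \<omega> i j > 0")
      case True
      then have "scaling_factor N (block_matrix m n R C (V \<omega>)) < a \<longleftrightarrow>
          (\<exists>q\<in>?Q. scaling_objective m n r c (V \<omega>) q < a)"
        by (intro scaling_factor_less_iff assms) auto
      then show ?thesis
        using True by auto
    next
      case False
      then show ?thesis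
        using nonpos[OF False] by auto
    qed
  qed
  then show "{\<omega> \<in> space M. scaling_factor N (block_matrix m n R C (V \<omega>)) < a} \<in> sets M"
    using pos U by auto
qed

section \<open>Expectation over exponential weights\<close>

lemma (in prob_space) exponential_monomial_expectation:
  fixes \<gamma> :: "nat \<Rightarrow> nat \<Rightarrow> 'a \<Rightarrow> real"
  assumes dist: "\<And>i j. i \<in> {1..m} \<Longrightarrow> j \<in> {1..n} \<Longrightarrow>
      distributed M lborel (\<gamma> i j) (exponential_density 1)"
    and indep: "indep_vars (\<lambda>_. borel) (\<lambda>(i, j). \<gamma> i j) ({1..m} \<times> {1..n})"
  shows "integrable M (\<lambda>\<omega>. \<Prod>i=1..m. \<Prod>j=1..n. (w i j * \<gamma> i j \<omega>) ^ D i j / fact (D i j))"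
    and "(\<integral>\<omega>. (\<Prod>i=1..m. \<Prod>j=1..n. (w i j * \<gamma> i j \<omega>) ^ D i j / fact (D i j)) \<partial>M) =
      (\<Prod>i=1..m. \<Prod>j=1..n. w i j ^ D i j)"
proof -
  let ?I = "{1..m} \<times> {1..n}"
  define X where "X p \<omega> = (w (fst p) (snd p) * \<gamma> (fst p) (snd p) \<omega>) ^ D (fst p) (snd p) / fact (D (fst p) (snd p))" for p \<omega>
  have X: "integrable M (X p)" "(\<integral>\<omega>. X p \<omega> \<partial>M) = w (fst p) (snd p) ^ D (fst p) (snd p)" if "p \<in> ?I" for p
  proof -
    \<comment> \<open>The exponential density is the Erlang density with parameter 0, whose moment
      formula gives d! and cancels the denominator.\<close>
    have d: "distributed M lborel (\<gamma> (fst p) (snd p)) (erlang_density 0 1)"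
      using dist that by auto
    show "integrable M (X p)"
      using erlang_ith_moment_integrable[OF _ d] by (simp add: X_def[abs_def] power_mult_distrib)
    show "(\<integral>\<omega>. X p \<omega> \<partial>M) = w (fst p) (snd p) ^ D (fst p) (snd p)"
      using erlang_ith_moment[OF _ d] by (simp add: X_def power_mult_distrib)
  qed
  have "indep_vars (\<lambda>_. borel)
      (\<lambda>p \<omega>. (\<lambda>x. (w (fst p) (snd p) * x) ^ D (fst p) (snd p) / fact (D (fst p) (snd p)))
        ((\<lambda>(i, j). \<gamma> i j) p \<omega>)) ?I"
    by (rule indep_vars_compose2[OF indep]) simp
  then have ind: "indep_vars (\<lambda>_. borel) X ?I"
    by (simp add: X_def[abs_def] case_prod_beta)
  have eq: "(\<Prod>i=1..m. \<Prod>j=1..n. (w i j * \<gamma> i j \<omega>) ^ D i j / fact (D i j)) = (\<Prod>p\<in>?I. X p \<omega>)" for \<omega>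
    by (simp add: prod.cartesian_product X_def case_prod_beta)
  have "finite ?I" by simp
  show "integrable M (\<lambda>\<omega>. \<Prod>i=1..m. \<Prod>j=1..n. (w i j * \<gamma> i j \<omega>) ^ D i j / fact (D i j))"
    unfolding eq by (rule indep_vars_integrable[OF \<open>finite ?I\<close> ind X(1)])
  have "(\<integral>\<omega>. (\<Prod>p\<in>?I. X p \<omega>) \<partial>M) = (\<Prod>p\<in>?I. \<integral>\<omega>. X p \<omega> \<partial>M)"
    by (rule indep_vars_lebesgue_integral[OF \<open>finite ?I\<close> ind X(1)])
  also have "\<dots> = (\<Prod>p\<in>?I. w (fst p) (snd p) ^ D (fst p) (snd p))"
    using X(2) by (intro prod.cong) auto
  also have "\<dots> = (\<Prod>i=1..m. \<Prod>j=1..n. w i j ^ D i j)"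
    by (simp add: prod.cartesian_product case_prod_beta)
  finally show "(\<integral>\<omega>. (\<Prod>i=1..m. \<Prod>j=1..n. (w i j * \<gamma> i j \<omega>) ^ D i j / fact (D i j)) \<partial>M) =
      (\<Prod>i=1..m. \<Prod>j=1..n. w i j ^ D i j)"
    unfolding eq .
qed

lemma (in prob_space) exponential_distributed_AE_pos:
  assumes "distributed M lborel X (exponential_density 1)"
  shows "AE \<omega> in M. X \<omega> > 0"
proof -
  have meas: "random_variable borel X"
    using distributed_measurable[OF assms] by simp
  have "\<P>(\<omega> in M. 0 < X \<omega>) = 1"
    using exponential_distributedD_gt[OF assms, of 0] by simp
  then show ?thesis
    using meas by (subst (asm) prob_Collect_eq_1) auto
qed

theorem theorem1p4:
  fixes m n N :: nat
    and r c :: "nat \<Rightarrow> nat"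
    and w :: "nat \<Rightarrow> nat \<Rightarrow> real"
    and R C :: "nat \<Rightarrow> nat set"
    and M :: "'a measure"
    and \<gamma> :: "nat \<Rightarrow> nat \<Rightarrow> 'a \<Rightarrow> real"
  assumes "m \<ge> 1" and "n \<ge> 1"
    and "\<And>i. i \<in> {1..m} \<Longrightarrow> r i > 0"
    and "\<And>j. j \<in> {1..n} \<Longrightarrow> c j > 0"
    and "(\<Sum>i=1..m. r i) = N" and "(\<Sum>j=1..n. c j) = N"
    and "\<And>i j. i \<in> {1..m} \<Longrightarrow> j \<in> {1..n} \<Longrightarrow> w i j > 0"
    and "partition_with_sizes N m r R" and "partition_with_sizes N n c C"
    and "prob_space M"
    and "\<And>i j. i \<in> {1..m} \<Longrightarrow> j \<in> {1..n} \<Longrightarrow>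
           distributed M lborel (\<gamma> i j) (exponential_density 1)"
    and "prob_space.indep_vars M (\<lambda>_. borel) (\<lambda>(i, j). \<gamma> i j) ({1..m} \<times> {1..n})"
  shows "approx_tables M N m n r c R C w \<gamma> \<le> weighted_tables m n r c w \<and>
    weighted_tables m n r c w \<le> approx_ratio N m n r c * approx_tables M N m n r c R C w \<gamma>"
proof -
  interpret prob_space M by fact
  note dist = assms(11) and indep = assms(12)
  let ?V = "\<lambda>\<omega> i j. w i j * \<gamma> i j \<omega>"
  let ?F = "(\<Prod>i=1..m. fact (r i)) * (\<Prod>j=1..n. fact (c j)) :: real"
  let ?\<alpha> = "min (\<Prod>i=1..m. fact (r i) / real (r i) ^ r i) (\<Prod>j=1..n. fact (c j) / real (c j) ^ c j)"
  define \<sigma> where "\<sigma> \<omega> = scaling_factor N (random_matrix m n R C w \<gamma> \<omega>)" for \<omega>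
  define P where "P \<omega> = ?F * table_sum m n r c (?V \<omega>)" for \<omega>
  have F: "?F > 0"
    by (intro mult_pos_pos prod_pos) auto
  have "r 1 > 0" using assms(1,3) by simp
  moreover have "r 1 \<le> (\<Sum>i=1..m. r i)"
    using assms(1) by (intro member_le_sum) auto
  ultimately have N: "N > 0" using assms(5) by simp
  have rv: "random_variable borel (\<gamma> i j)" if "i \<in> {1..m}" "j \<in> {1..n}" for i j
    using distributed_measurable[OF dist[OF that]] by simp
  have moment: "integrable M (\<lambda>\<omega>. \<Prod>i=1..m. \<Prod>j=1..n. ?V \<omega> i j ^ D i j / fact (D i j))"
    "(\<integral>\<omega>. (\<Prod>i=1..m. \<Prod>j=1..n. ?V \<omega> i j ^ D i j / fact (D i j)) \<partial>M) =
      (\<Prod>i=1..m. \<Prod>j=1..n. w i j ^ D i j)" for D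
    by (rule exponential_monomial_expectation; use dist indep in blast)+
  have P_int: "integrable M P"
    unfolding P_def table_sum_def
    by (intro integrable_mult_right Bochner_Integration.integrable_sum moment(1))
  have EP: "(\<integral>\<omega>. P \<omega> \<partial>M) = ?F * weighted_tables m n r c w"
    unfolding P_def table_sum_def weighted_tables_def
    by (simp only: integral_mult_right_zero Bochner_Integration.integral_sum[OF moment(1)] moment(2))
  \<comment> \<open>Positivity holds only almost surely; elsewhere the dummy value 0 may violate the
    upper bound.\<close>
  have "AE \<omega> in M. \<forall>i\<in>{1..m}. \<forall>j\<in>{1..n}. \<gamma> i j \<omega> > 0"
    using exponential_distributed_AE_pos[OF dist] by (intro AE_finite_allI) auto
  then have bounds: "AE \<omega> in M. 0 \<le> \<sigma> \<omega> \<and> fact N / real N ^ N * \<sigma> \<omega> \<le> P \<omega> \<and> P \<omega> \<le> ?\<alpha> * \<sigma> \<omega>"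
  proof eventually_elim
    case (elim \<omega>)
    then have V: "\<And>i j. i \<in> {1..m} \<Longrightarrow> j \<in> {1..n} \<Longrightarrow> ?V \<omega> i j > 0"
      using assms(7) by simp
    show ?case
      unfolding \<sigma>_def P_def random_matrix_def
      using scaling_factor_table_sum_bounds[of m n r c N "?V \<omega>" R C, OF assms(1-6) V assms(8,9)] by blast
  qed
  have \<sigma>_meas: "\<sigma> \<in> borel_measurable M"
    unfolding \<sigma>_def[abs_def] random_matrix_def
    by (rule scaling_factor_measurable[where r = r and c = c, OF assms(1-6) assms(8,9)])
      (use rv in \<open>auto intro!: borel_measurable_times\<close>)
  let ?k = "fact N / real N ^ N :: real"
  have k: "?k > 0" using N by simp
  \<comment> \<open>The pointwise lower bound for the permanent dominates \<sigma> by an integrable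
    multiple of \<open>P\<close>.\<close>
  have \<sigma>_int: "integrable M \<sigma>"
  proof (rule Bochner_Integration.integrable_bound)
    show "integrable M (\<lambda>\<omega>. P \<omega> / ?k)"
      using P_int by simp
    show "AE \<omega> in M. norm (\<sigma> \<omega>) \<le> norm (P \<omega> / ?k)"
      using bounds
    proof eventually_elim
      case (elim \<omega>)
      then have "\<sigma> \<omega> \<le> P \<omega> / ?k"
        using k by (subst pos_le_divide_eq) (simp_all only: mult.commute)
      with elim show ?case
        unfolding real_norm_def by linarith
    qed
  qed (fact \<sigma>_meas)
  have T': "approx_tables M N m n r c R C w \<gamma> = ?k * (\<integral>\<omega>. \<sigma> \<omega> \<partial>M) / ?F"
    by (simp add: approx_tables_def \<sigma>_def)
  have "(\<integral>\<omega>. ?k * \<sigma> \<omega> \<partial>M) \<le> (\<integral>\<omega>. P \<omega> \<partial>M)"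
    using bounds by (intro integral_mono_AE P_int integrable_mult_right \<sigma>_int) auto
  then have lower: "?k * (\<integral>\<omega>. \<sigma> \<omega> \<partial>M) \<le> ?F * weighted_tables m n r c w"
    unfolding EP by simp
  have "(\<integral>\<omega>. P \<omega> \<partial>M) \<le> (\<integral>\<omega>. ?\<alpha> * \<sigma> \<omega> \<partial>M)"
    using bounds by (intro integral_mono_AE P_int integrable_mult_right \<sigma>_int) auto
  then have upper: "?F * weighted_tables m n r c w \<le> ?\<alpha> * (\<integral>\<omega>. \<sigma> \<omega> \<partial>M)"
    unfolding EP by simp
  \<comment> \<open>The factor N^N / N! of the ratio undoes the normalisation in T'.\<close>
  have "?\<alpha> = approx_ratio N m n r c * ?k"
    using N by (simp add: approx_ratio_def)
  then have "approx_ratio N m n r c * approx_tables M N m n r c R C w \<gamma> = ?\<alpha> * (\<integral>\<omega>. \<sigma> \<omega> \<partial>M) / ?F"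
    unfolding T' by (simp only: mult.assoc times_divide_eq_right times_divide_eq_left)
  with lower upper F show ?thesis
    unfolding T' by (simp only: pos_divide_le_eq pos_le_divide_eq mult.commute)
qed

end
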